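(* Let $u\in V_{\bm\beta}$ be the solution of the least-squares problem $\mathcal{L}(u;\mathbf{f})=\min_{v\in V_{\bm\beta}}\mathcal{L}(v;\mathbf{f})$, and let $u_N\in\mathcal{M}(\boldsymbol{\theta},L)$ be a solution of the least-squares neural network problem $\mathcal{L}(u_N;\mathbf{f})=\min_{v\in\mathcal{M}(\boldsymbol{\theta},L)}\mathcal{L}(v;\mathbf{f})$. Then $$|||u-u_N|||_{\bm\beta}\le\left(\frac{M}{\alpha}\right)^{1/2}\inf_{v\in\mathcal{M}(\boldsymbol{\theta},L)}|||u-v|||_{\bm\beta},$$ where $\alpha,M>0$ are the constants in the norm equivalence $\alpha\,|||v|||_{\bm\beta}^2\le\mathcal{L}(v;\mathbf{0})\le M\,|||v|||_{\bm\beta}^2$ for all $v\in V_{\bm\beta}$.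
   Context: $\Omega\subset\mathbb{R}^d$ is a bounded domain with Lipschitz boundary $\Gamma$ and unit outward normal $\bm n$; $\bm\beta\in C^1(\bar\Omega)^d$; $\Gamma_-=\{\mathbf{x}\in\Gamma:\bm\beta(\mathbf{x})\cdot\bm n(\mathbf{x})<0\}$ is the inflow boundary. Given are $\gamma\in C(\bar\Omega)$, $f\in L^2(\Omega)$ and a bounded $g\in L^2(\Gamma_-)$, with $\gamma+\frac12\nabla\cdot\bm\beta\ge\gamma_0>0$ in $\Omega$ for some constant $\gamma_0$; put $\hat\gamma=\gamma+\nabla\cdot\bm\beta$. The problem is the advection-reaction equation $u_{\bm\beta}+\hat\gamma u=f$ in $\Omega$, $u=g$ on $\Gamma_-$, where $v_{\bm\beta}=\bm\beta\cdot\nabla v$ (weak directional derivative). The solution space is $V_{\bm\beta}=\{v\in L^2(\Omega):v_{\bm\beta}\in L^2(\Omega)\}$ with norm $|||v|||_{\bm\beta}=(\|v\|_{L^2(\Omega)}^2+\|v_{\bm\beta}\|_{L^2(\Omega)}^2)^{1/2}$. Also $\|v\|_{-\bm\beta}=\left(\int_{\Gamma_-}|\bm\beta\cdot\bm n|\,v^2\,ds\right)^{1/2}$, defined on $V_{\bm\beta}$ through traces. The least-squares functional is $\mathcal{L}(v;\mathbf{f})=\|v_{\bm\beta}+\hat\gamma v-f\|_{L^2(\Omega)}^2+\|v-g\|_{-\bm\beta}^2$ with $\mathbf{f}=(f,g)$; $\mathcal{L}(v;\mathbf{0})$ is the functional with $f=0$, $g=0$. It is a standing fact of the setting (to be taken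 as given) that there are positive constants $\alpha,M$ with $\alpha|||v|||_{\bm\beta}^2\le\mathcal{L}(v;\mathbf{0})\le M|||v|||_{\bm\beta}^2$ for all $v\in V_{\bm\beta}$, and that the minimizer $u$ of $\mathcal{L}(\cdot;\mathbf{f})$ over $V_{\bm\beta}$ exists, is unique, and solves the advection-reaction problem. For fixed integers $L\ge1$, $n_0=d$, $n_1,\dots,n_{L-1}\ge1$, $n_L=1$, the set $\mathcal{M}(\boldsymbol{\theta},L)$ consists of all ReLU network functions $\mathcal{N}=N^{(L)}\circ\cdots\circ N^{(1)}$, where $N^{(l)}(\mathbf{y})=\sigma(\boldsymbol\omega^{(l)}\mathbf{y}-\mathbf{b}^{(l)})$ for $l<L$ (with $\sigma(t)=\max\{0,t\}$ applied componentwise), $N^{(L)}(\mathbf{y})=\boldsymbol\omega^{(L)}\mathbf{y}-\mathbf{b}^{(L)}$ (no activation in the output layer), and $\boldsymbol\omega^{(l)}\in\mathbb{R}^{n_l\times n_{l-1}}$, $\mathbf{b}^{(l)}\in\mathbb{R}^{n_l}$ are arbitrary; $\boldsymbol{\theta}$ denotes all these parameters. Restricted to $\Omega$, $\mathcal{M}(\boldsymbol{\theta},L)\subset V_{\bm\beta}$. *)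

theory Defs
  imports "HOL-Analysis.Analysis" "Jordan_Normal_Form.Matrix"
begin

section \<open>Lipschitz domains, surface measure and outward normal\<close>

text \<open>Near each boundary point, in the direction of a unit vector \<open>e\<close>, the domain is the strict
  epigraph of a Lipschitz function \<open>h\<close> on the hyperplane orthogonal to \<open>e\<close>.\<close>

definition bounded_lipschitz_domain :: "'a::euclidean_space set \<Rightarrow> bool" where
  "bounded_lipschitz_domain \<Omega> \<longleftrightarrow>
     open \<Omega> \<and> connected \<Omega> \<and> bounded \<Omega> \<and> \<Omega> \<noteq> {} \<and>
     (\<forall>x\<in>frontier \<Omega>. \<exists>U e h K. open U \<and> x \<in> U \<and> norm e = 1 \<and>
        K-lipschitz_on {z. inner z e = 0} (h :: 'a \<Rightarrow> real) \<and>
        \<Omega> \<inter> U = {y \<in> U. h (y - inner y e *\<^sub>R e) < inner y e})"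

text \<open>The \<open>k\<close>-dimensional Hausdorff measure, normalised by the volume of the \<open>k\<close>-dimensional unit
  ball so that it is the usual surface area. The case distinction for the empty set only matters
  for \<open>k = 0\<close>, where \<open>0 ^ 0 = 1\<close>. Being a metric outer measure, \<open>hausdorff_outer\<close> is countably
  additive on the Borel sets, so that \<open>measure_of\<close> below yields its restriction to them.\<close>

definition hausdorff_premeasure :: "nat \<Rightarrow> real \<Rightarrow> 'a::metric_space set \<Rightarrow> ennreal" where
  "hausdorff_premeasure k \<delta> A =
     (INF U \<in> {U :: nat \<Rightarrow> 'a set. A \<subseteq> (\<Union>i. U i) \<and> (\<forall>i. bounded (U i) \<and> diameter (U i) \<le> \<delta>)}.
        (\<Sum>i. if U i = {} then 0 else ennreal (unit_ball_vol (real k) * (diameter (U i) / 2) ^ k)))"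

definition hausdorff_outer :: "nat \<Rightarrow> 'a::metric_space set \<Rightarrow> ennreal" where
  "hausdorff_outer k A = (SUP \<delta> \<in> {0<..}. hausdorff_premeasure k \<delta> A)"

definition hausdorff_measure :: "nat \<Rightarrow> 'a::metric_space measure" where
  "hausdorff_measure k = measure_of UNIV (sets borel) (hausdorff_outer k)"

definition surface_measure :: "'a::euclidean_space set \<Rightarrow> 'a measure" where
  "surface_measure \<Omega> = restrict_space (hausdorff_measure (DIM('a) - 1)) (frontier \<Omega>)"

text \<open>\<open>\<nu>\<close> is the outward unit normal of \<open>\<Omega>\<close> at \<open>x\<close> if, to first order at \<open>x\<close>, \<open>\<Omega>\<close> is the half-space
  \<open>{y. inner (y - x) \<nu> < 0}\<close>. Such a vector is unique. For a Lipschitz domain it exists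
  wherever the local graph function is differentiable, hence at almost every boundary point.\<close>

definition is_outward_normal_at :: "'a::euclidean_space set \<Rightarrow> 'a \<Rightarrow> 'a \<Rightarrow> bool" where
  "is_outward_normal_at \<Omega> x \<nu> \<longleftrightarrow> norm \<nu> = 1 \<and>
     (\<forall>\<epsilon>>0. \<exists>\<delta>>0. \<forall>y. dist y x < \<delta> \<longrightarrow>
        (y \<in> \<Omega> \<longrightarrow> inner (y - x) \<nu> \<le> \<epsilon> * dist y x) \<and>
        (y \<notin> \<Omega> \<longrightarrow> inner (y - x) \<nu> \<ge> - \<epsilon> * dist y x))"

definition outward_unit_normal :: "'a::euclidean_space set \<Rightarrow> ('a \<Rightarrow> 'a) \<Rightarrow> bool" where
  "outward_unit_normal \<Omega> \<nu> \<longleftrightarrow>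
     \<nu> \<in> borel_measurable (surface_measure \<Omega>) \<and>
     (AE x in surface_measure \<Omega>. is_outward_normal_at \<Omega> x (\<nu> x))"

definition inflow_boundary :: "'a::euclidean_space set \<Rightarrow> ('a \<Rightarrow> 'a) \<Rightarrow> ('a \<Rightarrow> 'a) \<Rightarrow> 'a set" where
  "inflow_boundary \<Omega> \<beta> \<nu> = {x \<in> frontier \<Omega>. inner (\<beta> x) (\<nu> x) < 0}"

section \<open>Function spaces\<close>

definition square_integrable :: "'b measure \<Rightarrow> ('b \<Rightarrow> real) \<Rightarrow> bool" where
  "square_integrable M f \<longleftrightarrow> f \<in> borel_measurable M \<and> integrable M (\<lambda>x. (f x)\<^sup>2)"

text \<open>Continuously differentiable on the open set \<open>\<Omega>\<close>, with the function and its derivative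
  extending continuously to the closure.\<close>

definition C1_closure ::
    "'a::euclidean_space set \<Rightarrow> ('a \<Rightarrow> 'b::real_normed_vector) \<Rightarrow> bool" where
  "C1_closure \<Omega> f \<longleftrightarrow> continuous_on (closure \<Omega>) f \<and>
     (\<exists>D :: 'a \<Rightarrow> 'a \<Rightarrow>\<^sub>L 'b. continuous_on (closure \<Omega>) D \<and>
        (\<forall>x\<in>\<Omega>. (f has_derivative blinfun_apply (D x)) (at x)))"

definition test_function :: "'a::euclidean_space set \<Rightarrow> ('a \<Rightarrow> real) \<Rightarrow> bool" where
  "test_function \<Omega> \<phi> \<longleftrightarrow> C1_closure UNIV \<phi> \<and>
     compact (closure {x. \<phi> x \<noteq> 0}) \<and> closure {x. \<phi> x \<noteq> 0} \<subseteq> \<Omega>"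

definition divergence :: "('a::euclidean_space \<Rightarrow> 'a) \<Rightarrow> 'a \<Rightarrow> real" where
  "divergence F x = (\<Sum>b\<in>Basis. inner (frechet_derivative F (at x) b) b)"

text \<open>Since \<open>\<beta>\<close> is only \<open>C\<^sup>1\<close>, the products \<open>\<phi>\<beta>\<close> are \<open>C\<^sup>1\<close> whether or not \<open>\<phi>\<close> is smoother;
  compactly supported \<open>C\<^sup>1\<close> test functions define the same weak derivative as smooth ones.\<close>

definition is_adv_deriv ::
    "'a::euclidean_space set \<Rightarrow> ('a \<Rightarrow> 'a) \<Rightarrow> ('a \<Rightarrow> real) \<Rightarrow> ('a \<Rightarrow> real) \<Rightarrow> bool" where
  "is_adv_deriv \<Omega> \<beta> v w \<longleftrightarrow> square_integrable (lebesgue_on \<Omega>) w \<and>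
     (\<forall>\<phi>. test_function \<Omega> \<phi> \<longrightarrow>
        (\<integral>x. w x * \<phi> x \<partial>lebesgue_on \<Omega>) =
        - (\<integral>x. v x * divergence (\<lambda>y. \<phi> y *\<^sub>R \<beta> y) x \<partial>lebesgue_on \<Omega>))"

definition V_space :: "'a::euclidean_space set \<Rightarrow> ('a \<Rightarrow> 'a) \<Rightarrow> ('a \<Rightarrow> real) set" where
  "V_space \<Omega> \<beta> = {v. square_integrable (lebesgue_on \<Omega>) v \<and> (\<exists>w. is_adv_deriv \<Omega> \<beta> v w)}"

definition adv_deriv ::
    "'a::euclidean_space set \<Rightarrow> ('a \<Rightarrow> 'a) \<Rightarrow> ('a \<Rightarrow> real) \<Rightarrow> 'a \<Rightarrow> real" where
  "adv_deriv \<Omega> \<beta> v = (SOME w. is_adv_deriv \<Omega> \<beta> v w)"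

definition graph_norm ::
    "'a::euclidean_space set \<Rightarrow> ('a \<Rightarrow> 'a) \<Rightarrow> ('a \<Rightarrow> real) \<Rightarrow> real" where
  "graph_norm \<Omega> \<beta> v =
     sqrt ((\<integral>x. (v x)\<^sup>2 \<partial>lebesgue_on \<Omega>) + (\<integral>x. (adv_deriv \<Omega> \<beta> v x)\<^sup>2 \<partial>lebesgue_on \<Omega>))"

text \<open>Elements of \<open>V_space\<close> have traces in the sense of Green's formula: \<open>t\<close> is the trace of \<open>v\<close> if
  \<open>(\<beta> \<bullet> \<nu>) t\<close> is the normal trace of \<open>v \<beta>\<close>, whose divergence is \<open>v\<^sub>\<beta> + v div \<beta>\<close>. This determines
  \<open>t\<close> almost everywhere on the part of the boundary where \<open>\<beta> \<bullet> \<nu> \<noteq> 0\<close>, and for \<open>v\<close> in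
  \<open>C\<^sup>1\<close> up to the boundary it is the restriction of \<open>v\<close>.\<close>

definition is_trace ::
    "'a::euclidean_space set \<Rightarrow> ('a \<Rightarrow> 'a) \<Rightarrow> ('a \<Rightarrow> 'a) \<Rightarrow> ('a \<Rightarrow> real) \<Rightarrow> ('a \<Rightarrow> real) \<Rightarrow> bool" where
  "is_trace \<Omega> \<beta> \<nu> v t \<longleftrightarrow>
     t \<in> borel_measurable (surface_measure \<Omega>) \<and>
     integrable (surface_measure \<Omega>) (\<lambda>x. inner (\<beta> x) (\<nu> x) * t x) \<and>
     (\<forall>\<phi>. C1_closure \<Omega> \<phi> \<longrightarrow>
        (\<integral>x. inner (\<beta> x) (\<nu> x) * t x * \<phi> x \<partial>surface_measure \<Omega>) =
        (\<integral>x. adv_deriv \<Omega> \<beta> v x * \<phi> x \<partial>lebesgue_on \<Omega>) +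
        (\<integral>x. v x * divergence (\<lambda>y. \<phi> y *\<^sub>R \<beta> y) x \<partial>lebesgue_on \<Omega>))"

definition trace ::
    "'a::euclidean_space set \<Rightarrow> ('a \<Rightarrow> 'a) \<Rightarrow> ('a \<Rightarrow> 'a) \<Rightarrow> ('a \<Rightarrow> real) \<Rightarrow> 'a \<Rightarrow> real" where
  "trace \<Omega> \<beta> \<nu> v = (SOME t. is_trace \<Omega> \<beta> \<nu> v t)"

section \<open>The least-squares functional\<close>

text \<open>The square of the weighted norm on the inflow boundary, of a function on the boundary.\<close>

definition inflow_norm_sq ::
    "'a::euclidean_space set \<Rightarrow> ('a \<Rightarrow> 'a) \<Rightarrow> ('a \<Rightarrow> 'a) \<Rightarrow> ('a \<Rightarrow> real) \<Rightarrow> ennreal" where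
  "inflow_norm_sq \<Omega> \<beta> \<nu> w =
     (\<integral>\<^sup>+x\<in>inflow_boundary \<Omega> \<beta> \<nu>. ennreal (\<bar>inner (\<beta> x) (\<nu> x)\<bar> * (w x)\<^sup>2) \<partial>surface_measure \<Omega>)"

definition adjusted_coeff ::
    "('a::euclidean_space \<Rightarrow> 'a) \<Rightarrow> ('a \<Rightarrow> real) \<Rightarrow> 'a \<Rightarrow> real" where
  "adjusted_coeff \<beta> \<gamma> x = \<gamma> x + divergence \<beta> x"

text \<open>The boundary term may be infinite, and it is infinite by convention if \<open>v\<close> has no trace. Hence
  an upper bound \<open>ls_functional \<dots> v \<le> M * (graph_norm \<dots> v)\<^sup>2\<close> contains the assertion that \<open>v\<close>
  has a trace of finite weighted norm.\<close>

definition ls_functional ::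
    "'a::euclidean_space set \<Rightarrow> ('a \<Rightarrow> 'a) \<Rightarrow> ('a \<Rightarrow> 'a) \<Rightarrow> ('a \<Rightarrow> real) \<Rightarrow>
     ('a \<Rightarrow> real) \<Rightarrow> ('a \<Rightarrow> real) \<Rightarrow> ('a \<Rightarrow> real) \<Rightarrow> ennreal" where
  "ls_functional \<Omega> \<beta> \<nu> \<gamma> f g v =
     (\<integral>\<^sup>+x. ennreal ((adv_deriv \<Omega> \<beta> v x + adjusted_coeff \<beta> \<gamma> x * v x - f x)\<^sup>2) \<partial>lebesgue_on \<Omega>) +
     (if \<exists>t. is_trace \<Omega> \<beta> \<nu> v t
      then inflow_norm_sq \<Omega> \<beta> \<nu> (\<lambda>x. trace \<Omega> \<beta> \<nu> v x - g x)
      else \<infinity>)"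

section \<open>ReLU networks\<close>

text \<open>An enumeration of the standard basis identifies \<open>'a\<close> with the coordinate vectors of length
  \<open>DIM('a)\<close>. Its choice does not affect the set of networks, as the first weight matrix is
  arbitrary.\<close>

definition basis_enum :: "nat \<Rightarrow> 'a::euclidean_space" where
  "basis_enum = (SOME e. bij_betw e {..<DIM('a)} Basis)"

definition coord_vec :: "'a::euclidean_space \<Rightarrow> real Matrix.vec" where
  "coord_vec x = Matrix.vec DIM('a) (\<lambda>i. inner x (basis_enum i))"

fun hidden_layers ::
    "(nat \<Rightarrow> real mat) \<Rightarrow> (nat \<Rightarrow> real Matrix.vec) \<Rightarrow> nat \<Rightarrow> real Matrix.vec \<Rightarrow> real Matrix.vec" where
  "hidden_layers W b 0 y = y"
| "hidden_layers W b (Suc l) y =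
     map_vec (max 0) (W (Suc l) *\<^sub>v hidden_layers W b l y - b (Suc l))"

definition network ::
    "(nat \<Rightarrow> real mat) \<Rightarrow> (nat \<Rightarrow> real Matrix.vec) \<Rightarrow> nat \<Rightarrow> 'a::euclidean_space \<Rightarrow> real" where
  "network W b L x = vec_index (W L *\<^sub>v hidden_layers W b (L - 1) (coord_vec x) - b L) 0"

definition relu_networks :: "(nat \<Rightarrow> nat) \<Rightarrow> nat \<Rightarrow> ('a::euclidean_space \<Rightarrow> real) set" where
  "relu_networks n L = {network W b L | W b.
     \<forall>l\<in>{1..L}. W l \<in> carrier_mat (n l) (n (l - 1)) \<and> b l \<in> carrier_vec (n l)}"

end

theory Submission
  imports Defs
begin

text \<open>The residual of the equation and the weighted trace are linear in \<open>v\<close>, so along a line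
  \<open>u + r w\<close> the functional is a quadratic polynomial in \<open>r\<close>. At a minimizer \<open>u\<close> over the whole space
  the linear coefficient vanishes, which yields the Pythagorean identity
  \<open>L(v; f) = L(u; f) + L(u - v; 0)\<close>. Minimality of \<open>u\<^sub>N\<close> then says \<open>L(u - u\<^sub>N; 0) \<le> L(u - v; 0)\<close> for every
  network \<open>v\<close>, and the norm equivalence turns this into the estimate.

  Since weak derivatives and traces are arbitrary representatives, linearity rests on their
  uniqueness almost everywhere: an integrable function orthogonal to all test functions has zero
  integral over all boxes, by approximating their indicators with \<open>C\<^sup>1\<close> bumps. Networks belong to
  the solution space because they are Lipschitz and locally affine off a null set.\<close>

section \<open>Square integrable functions\<close>

text \<open>The networks form no linear space, so minimality of \<open>u\<^sub>N\<close> gives no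
  orthogonality relation; it enters only as a comparison of two values of the functional.
  Orthogonality comes from u, whose minimality holds along every line in \<open>V_space\<close>, in
  particular along those towards networks.

  The functional takes values in \<open>ennreal\<close>, which shapes the bookkeeping: the upper
  bound of the norm equivalence makes it finite on \<open>V_space\<close> for zero data, finiteness
  yields traces together with the square integrability of their weighted versions, and only then can
  the expansion along lines be carried out with real integrals.

  A trace is determined only where \<beta> has a nonzero normal component. The weight of the
  boundary term vanishes on the remaining part, so this ambiguity does not reach the
  functional.\<close>

lemma square_integrable_measurable [measurable_dest]:
  "square_integrable M f \<Longrightarrow> f \<in> borel_measurable M"
  by (simp add: square_integrable_def)

lemma square_integrable_integrable_sq:
  "square_integrable M f \<Longrightarrow> integrable M (\<lambda>x. (f x)\<^sup>2)"
  by (simp add: square_integrable_def)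

lemma square_integrableI:
  "f \<in> borel_measurable M \<Longrightarrow> integrable M (\<lambda>x. (f x)\<^sup>2) \<Longrightarrow> square_integrable M f"
  by (simp add: square_integrable_def)

lemma square_integrable_mult:
  assumes [measurable]: "square_integrable M f" "square_integrable M g"
  shows "integrable M (\<lambda>x. f x * g x)"
proof (rule Bochner_Integration.integrable_bound)
  show "integrable M (\<lambda>x. (f x)\<^sup>2 + (g x)\<^sup>2)"
    by (intro Bochner_Integration.integrable_add square_integrable_integrable_sq assms)
  show "(\<lambda>x. f x * g x) \<in> borel_measurable M"
    by measurable
  have "\<bar>a * b\<bar> \<le> a\<^sup>2 + b\<^sup>2" for a b :: real
  proof -
    have "2 * \<bar>a * b\<bar> \<le> a\<^sup>2 + b\<^sup>2"
      using sum_squares_bound[of "\<bar>a\<bar>" "\<bar>b\<bar>"] by (simp add: abs_mult mult.assoc)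
    then show ?thesis
      using abs_ge_zero[of "a * b"] by linarith
  qed
  then show "AE x in M. norm (f x * g x) \<le> norm ((f x)\<^sup>2 + (g x)\<^sup>2)"
    by simp
qed

lemma square_integrable_add:
  assumes [measurable]: "square_integrable M f" "square_integrable M g"
  shows "square_integrable M (\<lambda>x. f x + g x)"
proof (rule square_integrableI)
  show "(\<lambda>x. f x + g x) \<in> borel_measurable M"
    by measurable
  have "integrable M (\<lambda>x. (f x)\<^sup>2 + (g x)\<^sup>2 + 2 * (f x * g x))"
    by (intro Bochner_Integration.integrable_add integrable_mult_right
        square_integrable_integrable_sq square_integrable_mult assms)
  then show "integrable M (\<lambda>x. (f x + g x)\<^sup>2)"
    by (simp add: power2_sum mult.assoc)
qed

lemma square_integrable_cmult:
  assumes [measurable]: "square_integrable M f"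
  shows "square_integrable M (\<lambda>x. c * f x)"
proof (rule square_integrableI)
  show "(\<lambda>x. c * f x) \<in> borel_measurable M"
    by measurable
  show "integrable M (\<lambda>x. (c * f x)\<^sup>2)"
    unfolding power_mult_distrib
    by (intro integrable_mult_right square_integrable_integrable_sq assms)
qed

lemma square_integrable_diff:
  assumes "square_integrable M f" "square_integrable M g"
  shows "square_integrable M (\<lambda>x. f x - g x)"
  using square_integrable_add[OF assms(1) square_integrable_cmult[OF assms(2), of "-1"]] by simp

lemma square_integrable_bounded_mult:
  assumes [measurable]: "square_integrable M f" "g \<in> borel_measurable M"
    and bound: "AE x in M. \<bar>g x\<bar> \<le> C"
  shows "square_integrable M (\<lambda>x. g x * f x)"
proof (rule square_integrableI, measurable, rule Bochner_Integration.integrable_bound)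
  show "integrable M (\<lambda>x. C\<^sup>2 * (f x)\<^sup>2)"
    by (intro integrable_mult_right square_integrable_integrable_sq assms)
  show "(\<lambda>x. (g x * f x)\<^sup>2) \<in> borel_measurable M"
    by measurable
  show "AE x in M. norm ((g x * f x)\<^sup>2) \<le> norm (C\<^sup>2 * (f x)\<^sup>2)"
    using bound
  proof eventually_elim
    case (elim x)
    have "(g x)\<^sup>2 \<le> C\<^sup>2"
      using power_mono[OF elim abs_ge_zero, of 2] unfolding power2_abs .
    then show ?case
      by (simp only: real_norm_def abs_mult power_mult_distrib abs_power2 mult_right_mono zero_le_power2)
  qed
qed

lemma square_integrable_bounded:
  assumes "finite_measure M" "f \<in> borel_measurable M" "AE x in M. \<bar>f x\<bar> \<le> C"
  shows "square_integrable M f"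
proof -
  have "square_integrable M (\<lambda>_. 1)"
    using assms(1) by (intro square_integrableI) (simp_all add: finite_measure.integrable_const)
  from square_integrable_bounded_mult[OF this assms(2,3)] show ?thesis
    by simp
qed

lemma integrable_bounded_mult:
  fixes f g :: "'b \<Rightarrow> real"
  assumes "integrable M f" and [measurable]: "g \<in> borel_measurable M"
    and bound: "\<And>x. x \<in> space M \<Longrightarrow> \<bar>g x\<bar> \<le> C"
  shows "integrable M (\<lambda>x. f x * g x)"
proof (rule Bochner_Integration.integrable_bound)
  have [measurable]: "f \<in> borel_measurable M"
    using assms(1) by measurable
  show "integrable M (\<lambda>x. C * f x)"
    by (intro integrable_mult_right assms)
  show "(\<lambda>x. f x * g x) \<in> borel_measurable M"
    by measurable
  have "\<bar>f x * g x\<bar> \<le> \<bar>C * f x\<bar>" if "x \<in> space M" for x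
  proof -
    have "\<bar>g x\<bar> \<le> \<bar>C\<bar>"
      using bound[OF that] by linarith
    then have "\<bar>g x\<bar> * \<bar>f x\<bar> \<le> \<bar>C\<bar> * \<bar>f x\<bar>"
      by (rule mult_right_mono) simp
    then show ?thesis
      by (simp add: abs_mult mult.commute)
  qed
  then show "AE x in M. norm (f x * g x) \<le> norm (C * f x)"
    by (intro AE_I2) simp
qed

section \<open>Continuously differentiable functions\<close>

lemma C1_closureE:
  assumes "C1_closure \<Omega> f"
  obtains D where "continuous_on (closure \<Omega>) f" "continuous_on (closure \<Omega>) D"
    "\<And>x. x \<in> \<Omega> \<Longrightarrow> (f has_derivative blinfun_apply (D x)) (at x)"
  using assms by (auto simp: C1_closure_def)

lemma C1_closureI:
  assumes "continuous_on (closure \<Omega>) f" "continuous_on (closure \<Omega>) D"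
    "\<And>x. x \<in> \<Omega> \<Longrightarrow> (f has_derivative blinfun_apply (D x)) (at x)"
  shows "C1_closure \<Omega> f"
  using assms by (auto simp: C1_closure_def)

lemma C1_closure_UNIV: "C1_closure UNIV f \<Longrightarrow> C1_closure \<Omega> f"
  by (auto simp: C1_closure_def elim!: continuous_on_subset intro: continuous_on_subset)

lemma C1_closure_scaleR:
  assumes "C1_closure \<Omega> f" "C1_closure \<Omega> G"
  shows "C1_closure \<Omega> (\<lambda>x. f x *\<^sub>R G x)"
proof -
  obtain D where D: "continuous_on (closure \<Omega>) f" "continuous_on (closure \<Omega>) D"
    "\<And>x. x \<in> \<Omega> \<Longrightarrow> (f has_derivative blinfun_apply (D x)) (at x)"
    using assms(1) by (rule C1_closureE) blast
  obtain E where E: "continuous_on (closure \<Omega>) G" "continuous_on (closure \<Omega>) E"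
    "\<And>x. x \<in> \<Omega> \<Longrightarrow> (G has_derivative blinfun_apply (E x)) (at x)"
    using assms(2) by (rule C1_closureE) blast
  show ?thesis
  proof (rule C1_closureI)
    show "continuous_on (closure \<Omega>) (\<lambda>x. f x *\<^sub>R G x)"
      by (intro continuous_intros D E)
    show "continuous_on (closure \<Omega>) (\<lambda>x. f x *\<^sub>R E x + (blinfun_scaleR_left (G x) o\<^sub>L D x))"
      by (intro continuous_intros D E)
    show "((\<lambda>x. f x *\<^sub>R G x) has_derivative
        blinfun_apply (f x *\<^sub>R E x + (blinfun_scaleR_left (G x) o\<^sub>L D x))) (at x)"
      if "x \<in> \<Omega>" for x
      by (rule has_derivative_eq_rhs, (rule derivative_intros D E that)+)
        (auto simp: blinfun.bilinear_simps)
  qed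
qed

lemma C1_closure_mult:
  fixes f g :: "'a::euclidean_space \<Rightarrow> real"
  shows "C1_closure \<Omega> f \<Longrightarrow> C1_closure \<Omega> g \<Longrightarrow> C1_closure \<Omega> (\<lambda>x. f x * g x)"
  using C1_closure_scaleR[of \<Omega> f g] by simp

lemma C1_closure_compose:
  fixes f :: "'a::euclidean_space \<Rightarrow> real" and h :: "real \<Rightarrow> real"
  assumes "C1_closure \<Omega> f" "\<And>t. (h has_real_derivative h' t) (at t)" "continuous_on UNIV h'"
  shows "C1_closure \<Omega> (\<lambda>x. h (f x))"
proof -
  obtain D where D: "continuous_on (closure \<Omega>) f" "continuous_on (closure \<Omega>) D"
    "\<And>x. x \<in> \<Omega> \<Longrightarrow> (f has_derivative blinfun_apply (D x)) (at x)"
    using assms(1) by (rule C1_closureE) blast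
  have h: "continuous_on UNIV h"
    using assms(2) by (meson DERIV_continuous_on has_field_derivative_at_within)
  show ?thesis
  proof (rule C1_closureI)
    show "continuous_on (closure \<Omega>) (\<lambda>x. h (f x))"
      by (rule continuous_on_compose2[OF h D(1)]) simp
    show "continuous_on (closure \<Omega>) (\<lambda>x. h' (f x) *\<^sub>R D x)"
      by (intro continuous_intros D continuous_on_compose2[OF assms(3) D(1)]) simp
    show "((\<lambda>x. h (f x)) has_derivative blinfun_apply (h' (f x) *\<^sub>R D x)) (at x)"
      if "x \<in> \<Omega>" for x
      using has_derivative_compose[OF D(3)[OF that]
          assms(2)[of "f x", unfolded has_field_derivative_def]]
      by (rule has_derivative_eq_rhs) (auto simp: blinfun.bilinear_simps)
  qed
qed

lemma C1_closure_const: "C1_closure \<Omega> (\<lambda>_. c)"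
  by (rule C1_closureI[where D = "\<lambda>_. 0"]) (simp_all add: zero_blinfun.rep_eq)

lemma C1_closure_inner: "C1_closure \<Omega> (\<lambda>x. inner x i)"
  by (rule C1_closureI[where D = "\<lambda>_. blinfun_inner_left i"]) (simp_all add: continuous_on_id continuous_on_inner bounded_linear.has_derivative[OF bounded_linear_inner_left] has_derivative_ident)

lemma C1_closure_inner_left:
  assumes "C1_closure \<Omega> G"
  shows "C1_closure \<Omega> (\<lambda>x. inner (G x) i)"
proof -
  obtain E where E: "continuous_on (closure \<Omega>) G" "continuous_on (closure \<Omega>) E"
    "\<And>x. x \<in> \<Omega> \<Longrightarrow> (G has_derivative blinfun_apply (E x)) (at x)"
    using assms by (rule C1_closureE) blast
  show ?thesis
  proof (rule C1_closureI)
    show "continuous_on (closure \<Omega>) (\<lambda>x. inner (G x) i)"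
      by (intro continuous_intros E)
    show "continuous_on (closure \<Omega>) (\<lambda>x. blinfun_inner_left i o\<^sub>L E x)"
      by (intro continuous_intros E)
    show "((\<lambda>x. inner (G x) i) has_derivative blinfun_apply (blinfun_inner_left i o\<^sub>L E x)) (at x)"
      if "x \<in> \<Omega>" for x
      using bounded_linear.has_derivative[OF bounded_linear_inner_left E(3)[OF that], of i]
      by (rule has_derivative_eq_rhs) auto
  qed
qed

lemma C1_closure_prod:
  fixes f :: "'i \<Rightarrow> 'a::euclidean_space \<Rightarrow> real"
  assumes "\<And>i. i \<in> I \<Longrightarrow> C1_closure \<Omega> (f i)"
  shows "C1_closure \<Omega> (\<lambda>x. \<Prod>i\<in>I. f i x)"
  using assms
  by (induction I rule: infinite_finite_induct) (auto intro!: C1_closure_const C1_closure_mult)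

lemma C1_closure_bounded:
  assumes "bounded \<Omega>" "C1_closure \<Omega> f"
  obtains C where "\<And>x. x \<in> closure \<Omega> \<Longrightarrow> norm (f x) \<le> C"
proof -
  have "bounded (f ` closure \<Omega>)"
    using assms by (auto simp: C1_closure_def intro!: compact_imp_bounded compact_continuous_image)
  then show ?thesis
    using that by (auto simp: bounded_iff)
qed

section \<open>Divergence of continuously differentiable fields\<close>

lemma divergence_eq:
  assumes "(F has_derivative F') (at x)"
  shows "divergence F x = (\<Sum>b\<in>Basis. inner (F' b) b)"
  using frechet_derivative_at[OF assms] by (simp add: divergence_def)

text \<open>At boundary points \<open>frechet_derivative\<close> may be an arbitrary value, so the
  claims concern \<Omega> only. There the divergence is the trace of the derivative, which extends
  continuously to the compact closure; boundedness is taken from that extension.\<close>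

lemma C1_closure_divergence:
  assumes "bounded \<Omega>" "C1_closure \<Omega> F"
  obtains C where "\<And>x. x \<in> \<Omega> \<Longrightarrow> \<bar>divergence F x\<bar> \<le> C" "continuous_on \<Omega> (divergence F)"
proof -
  obtain D where D: "continuous_on (closure \<Omega>) F" "continuous_on (closure \<Omega>) D"
    "\<And>x. x \<in> \<Omega> \<Longrightarrow> (F has_derivative blinfun_apply (D x)) (at x)"
    using assms(2) by (rule C1_closureE) blast
  define d where "d x = (\<Sum>b\<in>Basis. inner (D x b) b)" for x
  have cont: "continuous_on (closure \<Omega>) d"
    unfolding d_def by (intro continuous_intros D)
  have eq: "divergence F x = d x" if "x \<in> \<Omega>" for x
    using divergence_eq[OF D(3)[OF that]] by (simp add: d_def)
  have "bounded (d ` closure \<Omega>)"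
    using assms cont by (auto intro!: compact_imp_bounded compact_continuous_image)
  then obtain C where "\<And>x. x \<in> closure \<Omega> \<Longrightarrow> \<bar>d x\<bar> \<le> C"
    by (auto simp: bounded_iff)
  then have "\<And>x. x \<in> \<Omega> \<Longrightarrow> \<bar>divergence F x\<bar> \<le> C"
    using eq closure_subset[of \<Omega>] by auto
  moreover have "continuous_on \<Omega> (divergence F)"
    using continuous_on_subset[OF cont closure_subset] eq by (simp cong: continuous_on_cong)
  ultimately show ?thesis
    using that by blast
qed

text \<open>Squaring smooths the kink of the positive part: at 0 the difference quotient is bounded
  by |h|. The result is an elementary C1 function vanishing exactly on a half-line, the building
  block of bumps.\<close>

lemma has_real_derivative_max0_sq:
  "((\<lambda>t. (max 0 t)\<^sup>2) has_real_derivative 2 * max 0 t) (at t)" for t :: real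
proof -
  consider "t < 0" | "t = 0" | "t > 0" by linarith
  then show ?thesis
  proof cases
    case 1
    have "((\<lambda>t. 0) has_real_derivative 0) (at t)" by simp
    then have "((\<lambda>t. (max 0 t)\<^sup>2) has_real_derivative 0) (at t)"
      by (rule DERIV_cong_ev[THEN iffD1, rotated 3])
         (use 1 in \<open>auto intro!: eventually_mono[OF eventually_nhds_in_open[of "{..<0}"]]\<close>)
    with 1 show ?thesis by simp
  next
    case 2
    have "((\<lambda>h. (max 0 h)\<^sup>2 / h) \<longlongrightarrow> 0) (at (0::real))"
    proof (rule Lim_null_comparison)
      show "\<forall>\<^sub>F h in at (0::real). norm ((max 0 h)\<^sup>2 / h) \<le> \<bar>h\<bar>"
        by (rule always_eventually) (auto simp: max_def power2_eq_square)
      show "((\<lambda>h. \<bar>h\<bar>) \<longlongrightarrow> 0) (at (0::real))"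
        by (rule tendsto_rabs_zero) simp
    qed
    with 2 show ?thesis by (simp add: DERIV_def)
  next
    case 3
    have "((\<lambda>t. t\<^sup>2) has_real_derivative 2 * t) (at t)"
      by (auto intro!: derivative_eq_intros)
    then have "((\<lambda>t. (max 0 t)\<^sup>2) has_real_derivative 2 * t) (at t)"
      by (rule DERIV_cong_ev[THEN iffD1, rotated 3])
         (use 3 in \<open>auto intro!: eventually_mono[OF eventually_nhds_in_open[of "{0<..}"]]\<close>)
    with 3 show ?thesis by simp
  qed
qed

section \<open>Functions annihilating all test functions\<close>

text \<open>A product of squared positive parts, two for each coordinate, is a C1 function
  \<open>p\<close> that is nonzero exactly on the open box. The maps \<open>h n\<close> fix 0 and
  tend to 1 at every other point, so \<open>h n (p x)\<close> converges to the indicator; the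
  uniform bound 1 serves dominated convergence.\<close>

lemma box_bump:
  fixes a b :: "'a::euclidean_space"
  obtains \<phi> :: "nat \<Rightarrow> 'a \<Rightarrow> real"
  where "\<And>n. C1_closure UNIV (\<phi> n)" "\<And>n x. \<bar>\<phi> n x\<bar> \<le> 1"
    "\<And>n x. x \<notin> box a b \<Longrightarrow> \<phi> n x = 0"
    "\<And>x. (\<lambda>n. \<phi> n x) \<longlonglongrightarrow> indicator (box a b) x"
proof -
  define p where "p x = (\<Prod>i\<in>Basis. (max 0 (inner x i - inner a i))\<^sup>2 * (max 0 (inner b i - inner x i))\<^sup>2)"
    for x :: 'a
  have p0: "p x = 0" if "x \<notin> box a b" for x
  proof -
    obtain i :: 'a where "i \<in> Basis" "inner x i \<le> inner a i \<or> inner b i \<le> inner x i"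
      using \<open>x \<notin> box a b\<close> by (auto simp: mem_box not_less)
    then show ?thesis
      unfolding p_def by (intro prod_zero bexI[of _ i]) (auto simp: max_def)
  qed
  have p1: "p x \<noteq> 0" if "x \<in> box a b" for x
    using that unfolding p_def by (auto simp: mem_box max_def prod_zero_iff not_less not_le)
  have C1: "C1_closure UNIV p"
    unfolding p_def
  proof (intro C1_closure_prod C1_closure_mult)
    fix i :: 'a
    have 1: "((\<lambda>t. (max 0 (t - c))\<^sup>2) has_real_derivative 2 * max 0 (t - c)) (at t)" for c t :: real
    proof -
      have "((\<lambda>t. t - c) has_real_derivative 1) (at t)"
        by (auto intro!: derivative_eq_intros)
      from DERIV_chain2[OF has_real_derivative_max0_sq this] show ?thesis by simp
    qed
    have c1: "continuous_on UNIV (\<lambda>t. 2 * max 0 (t - c))" for c :: real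
      by (intro continuous_intros)
    show "C1_closure UNIV (\<lambda>x. (max 0 (inner x i - inner a i))\<^sup>2)"
      using C1_closure_compose[OF C1_closure_inner 1 c1] .
    have 2: "((\<lambda>t. (max 0 (c - t))\<^sup>2) has_real_derivative - (2 * max 0 (c - t))) (at t)" for c t :: real
    proof -
      have "((\<lambda>t. c - t) has_real_derivative - 1) (at t)"
        by (auto intro!: derivative_eq_intros)
      from DERIV_chain2[OF has_real_derivative_max0_sq this] show ?thesis by simp
    qed
    have c2: "continuous_on UNIV (\<lambda>t. - (2 * max 0 (c - t)))" for c :: real
      by (intro continuous_intros)
    show "C1_closure UNIV (\<lambda>x. (max 0 (inner b i - inner x i))\<^sup>2)"
      using C1_closure_compose[OF C1_closure_inner 2 c2] .
  qed
  \<comment> \<open>This is n t^2 / (n t^2 + 1). The square keeps the denominator at least 1 for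
    every real t, so \<open>h n\<close> is C1 on the whole line, as the composition with
    \<open>p\<close> demands.\<close>
  define h where "h n t = 1 - inverse (real n * t\<^sup>2 + 1)" for n and t :: real
  define h' where "h' n t = 2 * real n * t / (real n * t\<^sup>2 + 1)\<^sup>2" for n and t :: real
  have nz: "real n * t\<^sup>2 + 1 \<noteq> 0" "real n * t\<^sup>2 + 1 \<ge> 1" "real n * t\<^sup>2 + 1 > 0" for n and t :: real
    using mult_nonneg_nonneg[of "real n" "t\<^sup>2"] by (smt (verit) of_nat_0_le_iff zero_le_power2)+
  have h: "(h n has_real_derivative h' n t) (at t)" for n t
  proof -
    have "((\<lambda>t. real n * t\<^sup>2 + 1) has_real_derivative real n * (2 * t)) (at t)"
      by (auto intro!: derivative_eq_intros)
    from DERIV_diff[OF DERIV_const[of 1] DERIV_inverse_fun[OF this nz(1)]] show ?thesis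
      unfolding h_def h'_def by (rule DERIV_cong) (simp add: power2_eq_square field_simps)
  qed
  have h': "continuous_on UNIV (h' n)" for n
    unfolding h'_def using nz[of n] by (intro continuous_intros) auto
  show ?thesis
  proof
    show "C1_closure UNIV (\<lambda>x. h n (p x))" for n
      by (rule C1_closure_compose[OF C1 h h'])
    show "\<bar>h n (p x)\<bar> \<le> 1" for n x
    proof -
      have "0 < inverse (real n * (p x)\<^sup>2 + 1)" "inverse (real n * (p x)\<^sup>2 + 1) \<le> 1"
        using nz[of n "p x"] by (auto intro!: inverse_le_1_iff[THEN iffD2])
      then show ?thesis unfolding h_def by simp
    qed
    show "h n (p x) = 0" if "x \<notin> box a b" for n x
      by (simp add: p0[OF that] h_def)
    show "(\<lambda>n. h n (p x)) \<longlonglongrightarrow> indicator (box a b) x" for x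
    proof (cases "x \<in> box a b")
      case True
      have "filterlim (\<lambda>n. (p x)\<^sup>2 * real n) at_top sequentially"
        using p1[OF True] by (intro filterlim_tendsto_pos_mult_at_top[OF tendsto_const] filterlim_real_sequentially) simp
      then have "filterlim (\<lambda>n. 1 + (p x)\<^sup>2 * real n) at_top sequentially"
        by (rule filterlim_tendsto_add_at_top[OF tendsto_const])
      then have "(\<lambda>n. inverse (1 + (p x)\<^sup>2 * real n)) \<longlonglongrightarrow> 0"
        by (rule tendsto_inverse_0_at_top)
      from tendsto_diff[OF tendsto_const[of 1] this] True show ?thesis
        by (simp add: h_def ac_simps)
    next
      case False
      then show ?thesis by (simp add: p0 h_def)
    qed
  qed
qed

text \<open>The positive and negative parts of \<open>s\<close> are made into two measures. They
  agree on boxes, a generator closed under intersection, and hence on all Borel sets. Integrability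
  of \<open>s\<close> makes both finite whatever \<open>M\<close> is, so the lemma serves Lebesgue
  measure and surface measure alike.\<close>

lemma AE_zero_if_box_integrals_zero:
  fixes s :: "'a::euclidean_space \<Rightarrow> real"
  assumes sets: "sets M = sets (restrict_space borel S)" and s: "integrable M s"
    and box: "\<And>a b. (\<integral>x. indicator (box a b) x * s x \<partial>M) = 0"
  shows "AE x in M. s x = 0"
proof -
  have [measurable]: "s \<in> borel_measurable M" using s by measurable
  have space: "space M = S"
    using sets_eq_imp_space_eq[OF sets] by (simp add: space_restrict_space)
  have ident: "(\<lambda>x. x) \<in> measurable M borel"
    unfolding measurable_cong_sets[OF sets refl] by (rule measurable_restrict_space1) simp
  have ind[measurable]: "indicator A \<in> borel_measurable M" if "A \<in> sets borel" for A :: "'a set"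
    using measurable_compose[OF ident borel_measurable_indicator[OF that]] by simp
  \<comment> \<open>\<open>ennreal\<close> sends negative reals to 0, so \<open>\<mu> t\<close> has
    the positive part of \<open>t\<close> as its density. The pushforward carries it from
    \<open>S\<close> to the Borel sets of the whole space, which the boxes generate.\<close>
  define \<mu> where "\<mu> t = distr (density M (\<lambda>x. ennreal (t x))) borel (\<lambda>x. x)" for t :: "'a \<Rightarrow> real"
  have em: "emeasure (\<mu> t) A = (\<integral>\<^sup>+x. ennreal (indicator A x * t x) \<partial>M)"
    if [measurable]: "t \<in> borel_measurable M" "A \<in> sets borel" for t and A :: "'a set"
  proof -
    have A: "A \<inter> space M \<in> sets M"
      using measurable_sets[OF ident that(2)] by simp
    have "emeasure (\<mu> t) A = emeasure (density M (\<lambda>x. ennreal (t x))) (A \<inter> space M)"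
      unfolding \<mu>_def by (subst emeasure_distr) (use ident in \<open>auto\<close>)
    also have "\<dots> = (\<integral>\<^sup>+x. ennreal (t x) * indicator (A \<inter> space M) x \<partial>M)"
      by (rule emeasure_density) (use A in auto)
    also have "\<dots> = (\<integral>\<^sup>+x. ennreal (indicator A x * t x) \<partial>M)"
      by (rule nn_integral_cong) (auto simp: indicator_def)
    finally show ?thesis .
  qed
  have fin: "(\<integral>\<^sup>+x. ennreal (indicator A x * t x) \<partial>M) < \<infinity>"
    if "integrable M t" "A \<in> sets borel" for t and A :: "'a set"
  proof -
    have "(\<integral>\<^sup>+x. ennreal (indicator A x * t x) \<partial>M) \<le> (\<integral>\<^sup>+x. ennreal (norm (t x)) \<partial>M)"
      by (rule nn_integral_mono) (auto simp: indicator_def intro: ennreal_leI)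
    also have "\<dots> < \<infinity>"
      using that(1) by (simp add: integrable_iff_bounded)
    finally show ?thesis .
  qed
  have eq: "\<mu> s = \<mu> (\<lambda>x. - s x)"
  proof (rule measure_eqI_generator_eq)
    let ?E = "range (\<lambda>(a, b). box a b :: 'a set)"
    let ?A = "\<lambda>n::nat. box (- (real n *\<^sub>R One)) (real n *\<^sub>R One) :: 'a set"
    show "Int_stable ?E"
      by (auto simp: Int_stable_def box_Int_box)
    show "?E \<subseteq> Pow UNIV" "sets (\<mu> s) = sigma_sets UNIV ?E" "sets (\<mu> (\<lambda>x. - s x)) = sigma_sets UNIV ?E"
      by (simp_all add: \<mu>_def borel_eq_box)
    show "range ?A \<subseteq> ?E" "(\<Union>i. ?A i) = UNIV"
      unfolding UN_box_eq_UNIV by auto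
    show "emeasure (\<mu> s) (?A i) \<noteq> \<infinity>" for i
      using fin[OF s, of "?A i"] by (simp add: em)
    fix X assume "X \<in> ?E"
    then obtain a b where X: "X = box a b" by auto
    have i: "integrable M (\<lambda>x. indicator X x * s x)"
      using integrable_bounded_mult[OF s, of "indicator X" 1] unfolding X
      by (simp add: mult.commute ind)
    have fins: "(\<integral>\<^sup>+x. ennreal (indicator X x * s x) \<partial>M) < \<infinity>"
      "(\<integral>\<^sup>+x. ennreal (indicator X x * - s x) \<partial>M) < \<infinity>"
      using fin[OF s, of X] fin[of "\<lambda>x. - s x" X] s by (auto simp: X)
    have "enn2real (\<integral>\<^sup>+x. ennreal (indicator X x * s x) \<partial>M)
      = enn2real (\<integral>\<^sup>+x. ennreal (indicator X x * - s x) \<partial>M)"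
      using real_lebesgue_integral_def[OF i] box[of a b] by (simp add: X)
    then have "(\<integral>\<^sup>+x. ennreal (indicator X x * s x) \<partial>M) = (\<integral>\<^sup>+x. ennreal (indicator X x * - s x) \<partial>M)"
      using fins by (metis ennreal_enn2real infinity_ennreal_def)
    then show "emeasure (\<mu> s) X = emeasure (\<mu> (\<lambda>x. - s x)) X"
      by (simp add: em X)
  qed
  \<comment> \<open>On the set where \<open>t\<close> is positive the negative part has no mass, so
    equality of the two measures makes the positive part vanish there. Stated for \<open>t\<close>,
    this applies to \<open>s\<close> and to its negative.\<close>
  have half: "AE x in M. t x \<le> 0"
    if t: "\<mu> t = \<mu> (\<lambda>x. - t x)" and [measurable]: "t \<in> borel_measurable M" for t
  proof -
    have "{x \<in> space M. 0 < t x} \<in> sets M" by measurable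
    then obtain A where A: "A \<in> sets borel" "{x \<in> space M. 0 < t x} = S \<inter> A"
      unfolding sets by (auto simp: sets_restrict_space)
    then have mem: "x \<in> A \<longleftrightarrow> 0 < t x" if "x \<in> space M" for x
      using that by (auto simp: space)
    have "(\<integral>\<^sup>+x. ennreal (indicator A x * t x) \<partial>M) = (\<integral>\<^sup>+x. ennreal (indicator A x * - t x) \<partial>M)"
      using em[of t A] em[of "\<lambda>x. - t x" A] A(1) t by simp
    also have "\<dots> = (\<integral>\<^sup>+x. 0 \<partial>M)"
      by (rule nn_integral_cong) (use mem in \<open>auto simp: indicator_def ennreal_neg\<close>)
    finally have "AE x in M. ennreal (indicator A x * t x) = 0"
      using nn_integral_0_iff_AE[of "\<lambda>x. ennreal (indicator A x * t x)" M] A(1) by simp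
    then show ?thesis
      using AE_space by eventually_elim (use mem in \<open>auto simp: indicator_def not_less split: if_splits\<close>)
  qed
  have "AE x in M. s x \<le> 0"
    by (rule half[OF eq]) simp
  moreover have "AE x in M. - s x \<le> 0"
    by (rule half) (use eq in simp_all)
  ultimately show ?thesis
    by eventually_elim simp
qed

text \<open>Dominated convergence along the bumps of the box. The premise \<open>test\<close> is
  confined to \<phi> vanishing off the box, because in the interior only such functions are known to
  have their support in the domain. \<open>ident\<close> makes Borel functions measurable for
  \<open>M\<close>, whose sigma-algebra may be finer or live on a subset.\<close>

lemma integral_indicator_box_eq_0:
  fixes s :: "'a::euclidean_space \<Rightarrow> real"
  assumes s: "integrable M s" and ident: "(\<lambda>x. x) \<in> measurable M borel"
    and test: "\<And>\<phi>. C1_closure UNIV \<phi> \<Longrightarrow> (\<And>x. \<phi> x \<noteq> 0 \<Longrightarrow> x \<in> box a b) \<Longrightarrow> (\<integral>x. s x * \<phi> x \<partial>M) = 0"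
  shows "(\<integral>x. indicator (box a b) x * s x \<partial>M) = 0"
proof -
  have [measurable]: "s \<in> borel_measurable M" using s by measurable
  obtain \<phi> :: "nat \<Rightarrow> 'a \<Rightarrow> real" where \<phi>: "\<And>n. C1_closure UNIV (\<phi> n)" "\<And>n x. \<bar>\<phi> n x\<bar> \<le> 1"
    "\<And>n x. x \<notin> box a b \<Longrightarrow> \<phi> n x = 0"
    "\<And>x. (\<lambda>n. \<phi> n x) \<longlonglongrightarrow> indicator (box a b) x"
    using box_bump[of a b] by blast
  have [measurable]: "indicator (box a b) \<in> borel_measurable M"
    using measurable_compose[OF ident, of "indicator (box a b)" borel] by simp
  have [measurable]: "\<phi> n \<in> borel_measurable M" for n
    using measurable_compose[OF ident borel_measurable_continuous_onI[of "\<phi> n"]] \<phi>(1)[of n]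
    by (simp add: C1_closure_def)
  have "(\<lambda>n. \<integral>x. s x * \<phi> n x \<partial>M) \<longlonglongrightarrow> (\<integral>x. s x * indicator (box a b) x \<partial>M)"
  proof (rule integral_dominated_convergence[where w = "\<lambda>x. \<bar>s x\<bar>"])
    show "AE x in M. (\<lambda>n. s x * \<phi> n x) \<longlonglongrightarrow> s x * indicator (box a b) x"
      by (intro AE_I2 tendsto_intros \<phi>)
    show "AE x in M. norm (s x * \<phi> n x) \<le> \<bar>s x\<bar>" for n
      using \<phi>(2)[of n] by (auto simp: abs_mult intro!: mult_left_le)
    show "(\<lambda>x. s x * indicator (box a b) x) \<in> borel_measurable M"
      by measurable
    show "integrable M (\<lambda>x. \<bar>s x\<bar>)" using s by simp
  qed simp
  moreover have "(\<integral>x. s x * \<phi> n x \<partial>M) = 0" for n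
    by (rule test[OF \<phi>(1)]) (use \<phi>(3) in blast)
  ultimately show ?thesis
    using LIMSEQ_unique[OF tendsto_const[of 0]] by (simp add: mult.commute)
qed

text \<open>A bump on an arbitrary box need not have compact support in \<Omega>. The function is
  therefore cut off to an open box whose closure lies in \<Omega>, inside which all bumps are
  admissible; countably many such closed cells exhaust \<Omega>.\<close>

lemma AE_zero_if_test_integrals_zero:
  fixes w :: "'a::euclidean_space \<Rightarrow> real"
  assumes "open \<Omega>" "bounded \<Omega>" and w: "square_integrable (lebesgue_on \<Omega>) w"
    and test: "\<And>\<phi>. test_function \<Omega> \<phi> \<Longrightarrow> (\<integral>x. w x * \<phi> x \<partial>lebesgue_on \<Omega>) = 0"
  shows "AE x in lebesgue_on \<Omega>. w x = 0"
proof -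
  have \<Omega>: "\<Omega> \<in> sets lebesgue" using assms(1) by auto
  have fin: "finite_measure (lebesgue_on \<Omega>)"
    using assms by (intro finite_measure_lebesgue_on bounded_set_imp_lmeasurable) auto
  have int: "integrable (lebesgue_on \<Omega>) w"
    using square_integrable_mult[OF w square_integrable_bounded[OF fin, of "\<lambda>_. 1" 1]] by simp
  have ae_box: "AE x in lebesgue. x \<in> cbox c d \<longrightarrow> w x = 0" if cd: "cbox c d \<subseteq> \<Omega>" for c d
  proof -
    define s where "s x = indicator (box c d) x * w x" for x
    have "indicator (box c d) \<in> borel_measurable (lebesgue_on \<Omega>)"
      by (intro measurable_restrict_space1 borel_measurable_indicator) simp
    from integrable_bounded_mult[OF int this, of 1] have "integrable (lebesgue_on \<Omega>) s"
      by (simp add: s_def[abs_def] mult.commute)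
    then have s: "integrable lebesgue s"
      using \<Omega> cd box_subset_cbox[of c d]
      by (subst (asm) integrable_restrict_space) (auto simp: s_def indicator_def of_bool_def subset_eq intro: Bochner_Integration.integrable_cong[THEN iffD1, rotated -1])
    then have [measurable]: "s \<in> borel_measurable lebesgue"
      by measurable
    have [measurable]: "indicator (box a b) \<in> borel_measurable lebesgue" for a b :: 'a
      by (intro borel_measurable_indicator) simp
    \<comment> \<open>Box integrals are exploited on Borel sets, while \<open>w\<close> is only
      Lebesgue measurable; a Borel representative bridges the completion.\<close>
    obtain s' where [measurable]: "s' \<in> borel_measurable lborel" and s': "AE x in lborel. s x = s' x"
      using completion_ex_borel_measurable_real[of s lborel] s by auto
    have [measurable]: "s' \<in> borel_measurable lebesgue"
      by (rule measurable_completion) simp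
    have s's: "AE x in lebesgue. s x = s' x"
      using s' by (rule AE_completion)
    have s'int: "integrable lborel s'"
    proof -
      have "integrable lebesgue s'"
        by (rule integrable_cong_AE_imp[OF s measurable_completion s's]) simp
      then show ?thesis
        by (subst (asm) integrable_completion) simp_all
    qed
    have "AE x in lborel. s' x = 0"
    proof (rule AE_zero_if_box_integrals_zero[where S = UNIV])
      show "sets lborel = sets (restrict_space borel (UNIV :: 'a set))" by simp
      show "integrable lborel s'" by fact
      fix a b :: 'a
      \<comment> \<open>Integrating the truncated function over a box means integrating
        \<open>w\<close> over the intersection with the cell, again a box, and its bumps are test
        functions of \<Omega>.\<close>
      obtain a' b' where ab: "box a b \<inter> box c d = box a' b'"
        unfolding box_Int_box by blast
      have "(\<integral>x. indicator (box a b) x * s' x \<partial>lborel) = (\<integral>x. indicator (box a b) x * s' x \<partial>lebesgue)"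
        by (rule integral_completion[symmetric]) simp
      also have "\<dots> = (\<integral>x. indicator (box a b) x * s x \<partial>lebesgue)"
        by (rule integral_cong_AE) (use s's in auto)
      also have "\<dots> = (\<integral>x. indicator (box a' b') x * w x \<partial>lebesgue_on \<Omega>)"
        using \<Omega> subset_trans[OF box_subset_cbox cd] unfolding ab[symmetric]
        by (subst integral_restrict_space)
          (auto simp: s_def indicator_def subset_eq intro!: Bochner_Integration.integral_cong)
      also have "\<dots> = 0"
      proof (rule integral_indicator_box_eq_0[OF int])
        show "(\<lambda>x. x) \<in> measurable (lebesgue_on \<Omega>) borel"
          by (rule measurable_restrict_space1) (rule measurable_completion, simp)
        fix \<phi> :: "'a \<Rightarrow> real" assume \<phi>: "C1_closure UNIV \<phi>" "\<And>x. \<phi> x \<noteq> 0 \<Longrightarrow> x \<in> box a' b'"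
        have "closure {x. \<phi> x \<noteq> 0} \<subseteq> cbox c d"
          using \<phi>(2) ab box_subset_cbox[of c d] by (intro closure_minimal) auto
        moreover from this have "compact (closure {x. \<phi> x \<noteq> 0})"
          by (meson bounded_cbox bounded_subset closed_closure compact_eq_bounded_closed)
        ultimately have "test_function \<Omega> \<phi>"
          using \<phi>(1) cd by (auto simp: test_function_def)
        then show "(\<integral>x. w x * \<phi> x \<partial>lebesgue_on \<Omega>) = 0" by (rule test)
      qed
      finally show "(\<integral>x. indicator (box a b) x * s' x \<partial>lborel) = 0" .
    qed
    then have "AE x in lebesgue. s' x = 0" by (rule AE_completion)
    \<comment> \<open>The cutoff misses the faces of the closed cell, which form a null set.\<close>
    moreover have "AE x in lebesgue. x \<notin> cbox c d - box c d"
      using negligible_frontier_interval[of c d] unfolding negligible_iff_null_sets by (rule AE_not_in)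
    ultimately show ?thesis
      using s's by eventually_elim (auto simp: s_def)
  qed
  obtain D where D: "countable D" "\<And>X. X \<in> D \<Longrightarrow> \<exists>a b. X = cbox a b" "\<Union>D = \<Omega>"
    using open_countable_Union_open_cbox[OF assms(1)] by metis
  have "AE x in lebesgue. \<forall>X\<in>D. x \<in> X \<longrightarrow> w x = 0"
    using D ae_box by (subst AE_ball_countable) blast+
  then have "AE x in lebesgue. x \<in> \<Omega> \<longrightarrow> w x = 0"
    by eventually_elim (use D(3) in blast)
  then show ?thesis
    using \<Omega> by (simp add: AE_restrict_space_iff)
qed

section \<open>Weak derivatives of Lipschitz functions\<close>

lemma lborel_integrable_compact_support:
  fixes f :: "'a::euclidean_space \<Rightarrow> real"
  assumes "continuous_on UNIV f" "\<And>x. R \<le> norm x \<Longrightarrow> f x = 0"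
  shows "integrable lborel f"
proof -
  have "integrable lborel (\<lambda>x. indicator (cball 0 R) x *\<^sub>R f x)"
    by (intro borel_integrable_compact continuous_on_subset[OF assms(1)]) auto
  moreover have "(\<lambda>x. indicator (cball 0 R) x *\<^sub>R f x) = f"
    using assms(2) by (auto simp: indicator_def fun_eq_iff not_le)
  ultimately show ?thesis by simp
qed

lemma lborel_integral_translation:
  fixes f :: "'a::euclidean_space \<Rightarrow> real"
  assumes [measurable]: "f \<in> borel_measurable borel"
  shows "(\<integral>x. f (c + x) \<partial>lborel) = (\<integral>x. f x \<partial>lborel)"
  by (subst (2) lborel_distr_plus[symmetric, of c]) (simp add: integral_distr)

text \<open>A sequence of increments instead of all h tending to 0: limits of sequences preserve
  Borel measurability and fit dominated convergence. The increments are at most 1, which bounds how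
  far supports move.\<close>

abbreviation step :: "nat \<Rightarrow> real" where
  "step n \<equiv> inverse (real (Suc n))"

lemma step_filterlim: "filterlim step (at 0) sequentially"
  unfolding filterlim_at using LIMSEQ_inverse_real_of_nat by auto

lemma directional_limit:
  fixes f :: "'a::euclidean_space \<Rightarrow> real"
  assumes "(f has_derivative f') (at x)"
  shows "(\<lambda>n. (f (x + step n *\<^sub>R e) - f x) / step n) \<longlonglongrightarrow> f' e"
proof -
  have "((\<lambda>t. f (x + t *\<^sub>R e)) has_derivative (\<lambda>t. f' (t *\<^sub>R e))) (at 0)"
    by (rule has_derivative_compose[where f = "\<lambda>t. x + t *\<^sub>R e" and g = f])
       (auto intro!: derivative_eq_intros assms)
  then have "((\<lambda>t. f (x + t *\<^sub>R e)) has_real_derivative f' e) (at 0)"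
    unfolding has_field_derivative_def
    by (rule has_derivative_eq_rhs) (simp add: linear_cmul[OF has_derivative_linear[OF assms]] mult.commute fun_eq_iff)
  then have "(\<lambda>h. (f (x + h *\<^sub>R e) - f x) / h) \<midarrow>0\<rightarrow> f' e"
    by (simp add: DERIV_def)
  from filterlim_compose[OF this step_filterlim] show ?thesis .
qed

text \<open>Difference quotients can be moved from one factor to the other by translation invariance,
  and both sides converge by dominated convergence.\<close>

lemma lborel_integral_by_parts:
  fixes \<psi> v :: "'a::euclidean_space \<Rightarrow> real"
  assumes \<psi>: "\<And>x. (\<psi> has_derivative D x) (at x)" "C-lipschitz_on UNIV \<psi>"
      "\<And>x. R \<le> norm x \<Longrightarrow> \<psi> x = 0"
    and v: "K-lipschitz_on UNIV v"
    and e: "norm e \<le> 1"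
    and G[measurable]: "G \<in> borel_measurable borel"
    and lim: "AE x in lborel. (\<lambda>n. (v (x - step n *\<^sub>R e) - v x) / step n) \<longlonglongrightarrow> - G x"
  shows "integrable lborel (\<lambda>x. v x * D x e)" "integrable lborel (\<lambda>x. G x * \<psi> x)"
    "(\<integral>x. v x * D x e \<partial>lborel) = - (\<integral>x. G x * \<psi> x \<partial>lborel)"
proof -
  have cont: "continuous_on UNIV \<psi>" "continuous_on UNIV v"
    using \<psi>(2) v by (auto intro: lipschitz_on_continuous_on)
  note [measurable] = borel_measurable_continuous_onI[OF cont(1)] borel_measurable_continuous_onI[OF cont(2)]
  define Q where "Q n x = (\<psi> (x + step n *\<^sub>R e) - \<psi> x) / step n" for n x
  \<comment> \<open>Moving a forward shift from \<psi> to v turns it into a backward shift, so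
    \<open>P n\<close> tends to the negative of the directional derivative \<open>G\<close>; this is
    the minus sign of integration by parts.\<close>
  define P where "P n x = (v (x - step n *\<^sub>R e) - v x) / step n" for n x
  have [measurable]: "Q n \<in> borel_measurable borel" "P n \<in> borel_measurable borel" for n
    unfolding Q_def P_def by measurable
  have step: "0 < step n" "step n \<le> 1" for n
    by (auto simp: field_simps)
  have Q_lim: "(\<lambda>n. Q n x) \<longlonglongrightarrow> D x e" for x
    unfolding Q_def by (rule directional_limit[OF \<psi>(1)])
  have [measurable]: "(\<lambda>x. D x e) \<in> borel_measurable borel"
    by (rule borel_measurable_LIMSEQ_real[OF Q_lim]) measurable
  have C: "0 \<le> C" "0 \<le> K"
    using \<psi>(2) v by (auto simp: lipschitz_on_def)
  have quot: "\<bar>(f (x + t *\<^sub>R e) - f x) / step n\<bar> \<le> B"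
    if "B-lipschitz_on UNIV f" "\<bar>t\<bar> = step n" for f :: "'a \<Rightarrow> real" and B t x n
  proof -
    have "\<bar>f (x + t *\<^sub>R e) - f x\<bar> \<le> B * norm (t *\<^sub>R e)"
      using lipschitz_onD[OF that(1), of "x + t *\<^sub>R e" x] by (simp add: dist_norm)
    also have "\<dots> \<le> B * step n"
      using that e step[of n] lipschitz_on_nonneg[OF that(1)]
      by (intro mult_left_mono) (simp_all add: mult_left_le)
    finally show ?thesis
      using step[of n] by (simp add: abs_div_pos[symmetric] pos_divide_le_eq del: of_nat_Suc)
  qed
  have Q_bound: "\<bar>Q n x\<bar> \<le> C" for n x
    unfolding Q_def using quot[OF \<psi>(2), of "step n" n x] step[of n] by simp
  have P_bound: "\<bar>P n x\<bar> \<le> K" for n x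
    unfolding P_def using quot[OF v, of "- step n" n x] step[of n] by simp
  have Q_zero: "Q n x = 0" if "R + 1 \<le> norm x" for n x
  proof -
    have "norm (step n *\<^sub>R e) \<le> 1"
      using step[of n] e by (simp add: mult_le_one)
    then have "R \<le> norm (x + step n *\<^sub>R e)"
      using that norm_triangle_ineq4[of "x + step n *\<^sub>R e" "step n *\<^sub>R e"] by simp
    then show ?thesis
      using \<psi>(3)[of x] \<psi>(3)[of "x + step n *\<^sub>R e"] that by (simp add: Q_def)
  qed
  have swap: "(\<integral>x. v x * Q n x \<partial>lborel) = (\<integral>x. P n x * \<psi> x \<partial>lborel)" for n
  proof -
    let ?h = "step n *\<^sub>R e"
    have i1: "integrable lborel (\<lambda>x. v x * \<psi> (x + ?h))"
    proof (rule lborel_integrable_compact_support[where R = "R + norm ?h"])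
      show "continuous_on UNIV (\<lambda>x. v x * \<psi> (x + ?h))"
        by (intro continuous_intros cont continuous_on_compose2[OF cont(1)]) auto
      show "v x * \<psi> (x + ?h) = 0" if "R + norm ?h \<le> norm x" for x
        using that norm_triangle_ineq4[of "x + ?h" ?h] \<psi>(3)[of "x + ?h"] by simp
    qed
    have i2: "integrable lborel (\<lambda>x. v x * \<psi> x)"
      by (rule lborel_integrable_compact_support[where R = R]) (auto intro!: continuous_intros cont simp: \<psi>(3))
    have i3: "integrable lborel (\<lambda>x. v (x - ?h) * \<psi> x)"
    proof (rule lborel_integrable_compact_support[where R = R])
      show "continuous_on UNIV (\<lambda>x. v (x - ?h) * \<psi> x)"
        by (intro continuous_intros cont continuous_on_compose2[OF cont(2)]) auto
    qed (simp add: \<psi>(3))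
    have "(\<integral>x. v x * \<psi> (x + ?h) \<partial>lborel) = (\<integral>x. v (x - ?h) * \<psi> x \<partial>lborel)"
      using lborel_integral_translation[of "\<lambda>x. v (x - ?h) * \<psi> x" ?h] by (simp add: add.commute)
    then have "(\<integral>x. v x * \<psi> (x + ?h) - v x * \<psi> x \<partial>lborel) = (\<integral>x. v (x - ?h) * \<psi> x - v x * \<psi> x \<partial>lborel)"
      using i1 i2 i3 by simp
    then have "(\<integral>x. v x * \<psi> (x + ?h) - v x * \<psi> x \<partial>lborel) / step n
      = (\<integral>x. v (x - ?h) * \<psi> x - v x * \<psi> x \<partial>lborel) / step n"
      by simp
    then show ?thesis
      unfolding Q_def P_def
      by (simp add: integral_divide_zero[symmetric] right_diff_distrib left_diff_distrib diff_divide_distrib del: of_nat_Suc)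
  qed
  \<comment> \<open>v may grow at infinity, but \<open>Q n\<close> vanishes outside the ball of
    radius R + 1, where the extra 1 absorbs the shift. Cutting off there gives one integrable
    majorant for all n.\<close>
  define W where "W x = \<bar>indicator (cball 0 (R + 1)) x *\<^sub>R (C * v x)\<bar>" for x
  have W: "integrable lborel W"
    unfolding W_def
    by (intro integrable_abs borel_integrable_compact continuous_intros continuous_on_subset[OF cont(2)]) auto
  have dom1: "AE x in lborel. norm (v x * Q n x) \<le> W x" for n
  proof (rule AE_I2)
    fix x
    show "norm (v x * Q n x) \<le> W x"
      using mult_right_mono[OF Q_bound[of n x] abs_ge_zero[of "v x"]] Q_zero[of x n] C
      by (cases "norm x \<le> R + 1") (auto simp: W_def abs_mult mult.commute)
  qed
  have lim1: "AE x in lborel. (\<lambda>n. v x * Q n x) \<longlonglongrightarrow> v x * D x e"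
    by (intro AE_I2 tendsto_intros Q_lim)
  have i\<psi>: "integrable lborel (\<lambda>x. K * \<bar>\<psi> x\<bar>)"
    by (intro integrable_mult_right integrable_abs lborel_integrable_compact_support[OF cont(1) \<psi>(3)])
  have dom2: "AE x in lborel. norm (P n x * \<psi> x) \<le> K * \<bar>\<psi> x\<bar>" for n
    using mult_right_mono[OF P_bound[of n] abs_ge_zero] by (auto simp: abs_mult)
  have lim2: "AE x in lborel. (\<lambda>n. P n x * \<psi> x) \<longlonglongrightarrow> - G x * \<psi> x"
    using lim by eventually_elim (rule tendsto_mult[OF _ tendsto_const], simp only: P_def)
  show "integrable lborel (\<lambda>x. v x * D x e)"
    by (rule integrable_dominated_convergence[OF _ _ W lim1 dom1]) measurable
  have "integrable lborel (\<lambda>x. - G x * \<psi> x)"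
    by (rule integrable_dominated_convergence[OF _ _ i\<psi> lim2 dom2]) measurable
  then show "integrable lborel (\<lambda>x. G x * \<psi> x)"
    by simp
  have "(\<lambda>n. \<integral>x. v x * Q n x \<partial>lborel) \<longlonglongrightarrow> (\<integral>x. v x * D x e \<partial>lborel)"
    by (rule integral_dominated_convergence[OF _ _ W lim1 dom1]) measurable
  moreover have "(\<lambda>n. \<integral>x. P n x * \<psi> x \<partial>lborel) \<longlonglongrightarrow> (\<integral>x. - G x * \<psi> x \<partial>lborel)"
    by (rule integral_dominated_convergence[OF _ _ i\<psi> lim2 dom2]) measurable
  ultimately have "(\<integral>x. v x * D x e \<partial>lborel) = (\<integral>x. - G x * \<psi> x \<partial>lborel)"
    unfolding swap by (rule LIMSEQ_unique)
  then show "(\<integral>x. v x * D x e \<partial>lborel) = - (\<integral>x. G x * \<psi> x \<partial>lborel)"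
    by simp
qed

section \<open>Networks as piecewise affine functions\<close>

text \<open>Local affinity off a null set alone would admit step functions, whose distributional
  derivatives are concentrated on that set; the Lipschitz condition excludes jumps. Equality near x,
  not merely at x, yields derivatives, and finiteness of \<open>A\<close> keeps the exceptional set
  null when an activation adds the zero sets of the pieces.\<close>

definition piecewise_affine :: "('a::euclidean_space \<Rightarrow> real) \<Rightarrow> bool" where
  "piecewise_affine v \<longleftrightarrow> (\<exists>K. K-lipschitz_on UNIV v) \<and>
     (\<exists>A N. finite A \<and> negligible N \<and>
        (\<forall>x. x \<notin> N \<longrightarrow> (\<exists>(a, c)\<in>A. \<forall>\<^sub>F y in nhds x. v y = inner a y + c)))"

lemma piecewise_affineE:
  assumes "piecewise_affine v"
  obtains K A N where "K-lipschitz_on UNIV v" "finite A" "negligible N"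
    "\<And>x. x \<notin> N \<Longrightarrow> \<exists>(a, c)\<in>A. \<forall>\<^sub>F y in nhds x. v y = inner a y + c"
  using assms unfolding piecewise_affine_def by blast

lemma piecewise_affineI:
  assumes "K-lipschitz_on UNIV v" "finite A" "negligible N"
    "\<And>x. x \<notin> N \<Longrightarrow> \<exists>(a, c)\<in>A. \<forall>\<^sub>F y in nhds x. v y = inner a y + c"
  shows "piecewise_affine v"
  using assms unfolding piecewise_affine_def by blast

lemma piecewise_affine_inner: "piecewise_affine (\<lambda>x. inner x a)"
proof (rule piecewise_affineI)
  show "(norm a)-lipschitz_on UNIV (\<lambda>x. inner x a)"
    by (rule lipschitz_onI)
      (simp_all add: dist_norm inner_diff_left[symmetric] mult.commute[of "norm a"] Cauchy_Schwarz_ineq2)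
  show "\<exists>(a', c)\<in>{(a, 0)}. \<forall>\<^sub>F y in nhds x. inner y a = inner a' y + c" for x
    by (simp add: inner_commute)
qed auto

lemma piecewise_affine_const: "piecewise_affine (\<lambda>_. c)"
  by (rule piecewise_affineI[where K = 0 and A = "{(0, c)}" and N = "{}"])
    (auto intro!: lipschitz_onI)

lemma piecewise_affine_add:
  assumes "piecewise_affine v" "piecewise_affine w"
  shows "piecewise_affine (\<lambda>x. v x + w x)"
proof -
  obtain K A N where v: "K-lipschitz_on UNIV v" "finite A" "negligible N"
    "\<And>x. x \<notin> N \<Longrightarrow> \<exists>(a, c)\<in>A. \<forall>\<^sub>F y in nhds x. v y = inner a y + c"
    using assms(1) by (rule piecewise_affineE) blast
  obtain K' A' N' where w: "K'-lipschitz_on UNIV w" "finite A'" "negligible N'"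
    "\<And>x. x \<notin> N' \<Longrightarrow> \<exists>(a, c)\<in>A'. \<forall>\<^sub>F y in nhds x. w y = inner a y + c"
    using assms(2) by (rule piecewise_affineE) blast
  show ?thesis
  proof (rule piecewise_affineI)
    show "(K + K')-lipschitz_on UNIV (\<lambda>x. v x + w x)"
      by (intro lipschitz_on_add v w)
    show "finite ((\<lambda>(p, q). p + q) ` (A \<times> A'))" "negligible (N \<union> N')"
      using v w by auto
    fix x assume "x \<notin> N \<union> N'"
    then obtain a c a' c' where *: "(a, c) \<in> A" "\<forall>\<^sub>F y in nhds x. v y = inner a y + c"
      "(a', c') \<in> A'" "\<forall>\<^sub>F y in nhds x. w y = inner a' y + c'"
      using v(4)[of x] w(4)[of x] by blast
    have "\<forall>\<^sub>F y in nhds x. v y + w y = inner (a + a') y + (c + c')"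
      using *(2,4) by eventually_elim (simp add: inner_add_left)
    moreover have "(a + a', c + c') \<in> (\<lambda>(p, q). p + q) ` (A \<times> A')"
      using *(1,3) by (auto intro!: rev_image_eqI[of "((a, c), (a', c'))"])
    ultimately show "\<exists>(a, c)\<in>(\<lambda>(p, q). p + q) ` (A \<times> A'). \<forall>\<^sub>F y in nhds x. v y + w y = inner a y + c"
      by blast
  qed
qed

lemma piecewise_affine_cmult:
  assumes "piecewise_affine v"
  shows "piecewise_affine (\<lambda>x. r * v x)"
proof -
  obtain K A N where v: "K-lipschitz_on UNIV v" "finite A" "negligible N"
    "\<And>x. x \<notin> N \<Longrightarrow> \<exists>(a, c)\<in>A. \<forall>\<^sub>F y in nhds x. v y = inner a y + c"
    using assms by (rule piecewise_affineE) blast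
  show ?thesis
  proof (rule piecewise_affineI)
    show "(\<bar>r\<bar> * K)-lipschitz_on UNIV (\<lambda>x. r * v x)"
      by (intro lipschitz_on_cmult_real v)
    show "finite ((\<lambda>p. r *\<^sub>R p) ` A)" "negligible N"
      using v by auto
    fix x assume "x \<notin> N"
    then obtain a c where *: "(a, c) \<in> A" "\<forall>\<^sub>F y in nhds x. v y = inner a y + c"
      using v(4)[of x] by blast
    have "\<forall>\<^sub>F y in nhds x. r * v y = inner (r *\<^sub>R a) y + r * c"
      using *(2) by eventually_elim (simp add: distrib_left)
    moreover have "(r *\<^sub>R a, r * c) \<in> (\<lambda>p. r *\<^sub>R p) ` A"
      using *(1) by (auto intro!: rev_image_eqI[of "(a, c)"])
    ultimately show "\<exists>(a, c)\<in>(\<lambda>p. r *\<^sub>R p) ` A. \<forall>\<^sub>F y in nhds x. r * v y = inner a y + c"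
      by blast
  qed
qed

lemma piecewise_affine_sum:
  assumes "\<And>i. i \<in> I \<Longrightarrow> piecewise_affine (f i)"
  shows "piecewise_affine (\<lambda>x. \<Sum>i\<in>I. f i x)"
  using assms
  by (induction I rule: infinite_finite_induct)
    (auto intro!: piecewise_affine_const piecewise_affine_add)

text \<open>The new exceptional set consists of the zero sets of the nonzero affine pieces.\<close>

lemma piecewise_affine_max0:
  assumes "piecewise_affine v"
  shows "piecewise_affine (\<lambda>x. max 0 (v x))"
proof -
  obtain K A N where v: "K-lipschitz_on UNIV v" "finite A" "negligible N"
    "\<And>x. x \<notin> N \<Longrightarrow> \<exists>(a, c)\<in>A. \<forall>\<^sub>F y in nhds x. v y = inner a y + c"
    using assms by (rule piecewise_affineE) blast
  define Z where "Z = (\<lambda>(a, c). {x. inner a x = - c}) ` (A - {(0, 0)})"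
  show ?thesis
  proof (rule piecewise_affineI)
    show "K-lipschitz_on UNIV (\<lambda>x. max 0 (v x))"
    proof (rule lipschitz_onI)
      fix x y
      have "dist (max 0 (v x)) (max 0 (v y)) \<le> dist (v x) (v y)"
        by (auto simp: dist_real_def max_def)
      also have "\<dots> \<le> K * dist x y"
        by (rule lipschitz_onD[OF v(1)]) auto
      finally show "dist (max 0 (v x)) (max 0 (v y)) \<le> K * dist x y" .
    qed (rule lipschitz_on_nonneg[OF v(1)])
    show "finite (insert (0, 0) A)"
      using v by simp
    have "negligible (\<Union>Z)"
    proof (rule negligible_Union)
      show "finite Z" unfolding Z_def using v(2) by auto
      show "negligible S" if "S \<in> Z" for S
        using that unfolding Z_def by (auto intro!: negligible_hyperplane)
    qed
    then show "negligible (N \<union> \<Union>Z)"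
      using v by auto
    fix x assume x: "x \<notin> N \<union> \<Union>Z"
    then obtain a c where *: "(a, c) \<in> A" "\<forall>\<^sub>F y in nhds x. v y = inner a y + c"
      using v(4)[of x] by blast
    have cont: "((\<lambda>y. inner a y + c) \<longlongrightarrow> inner a x + c) (nhds x)"
      by (intro tendsto_intros filterlim_ident)
    \<comment> \<open>Off the removed sets a piece is either identically zero or has a strict sign
      at x, which persists nearby by continuity. A nonzero constant piece contributes only the empty
      set to \<open>Z\<close> and falls under the strict cases.\<close>
    consider "(a, c) = (0, 0)" | "inner a x + c < 0" | "inner a x + c > 0"
      using x *(1) unfolding Z_def by (force simp: add_eq_0_iff2)
    then show "\<exists>(a, c)\<in>insert (0, 0) A. \<forall>\<^sub>F y in nhds x. max 0 (v y) = inner a y + c"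
    proof cases
      case 1
      then have "\<forall>\<^sub>F y in nhds x. max 0 (v y) = inner 0 y + 0"
        using *(2) by (auto elim!: eventually_mono)
      then show ?thesis by blast
    next
      case 2
      have "\<forall>\<^sub>F y in nhds x. max 0 (v y) = inner 0 y + 0"
        using *(2) order_tendstoD(2)[OF cont 2] by eventually_elim simp
      then show ?thesis by blast
    next
      case 3
      have "\<forall>\<^sub>F y in nhds x. max 0 (v y) = inner a y + c"
        using *(2) order_tendstoD(1)[OF cont 3] by eventually_elim simp
      then show ?thesis using *(1) by blast
    qed
  qed
qed

text \<open>The affine part of a layer, before activation: hidden layers follow it by the positive
  part, the output layer takes it as it is.\<close>

lemma piecewise_affine_layer:
  assumes W: "W \<in> carrier_mat m k" and b: "b \<in> carrier_vec m"
    and dim: "\<And>x. dim_vec (h x) = k"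
    and h: "\<And>j. j < k \<Longrightarrow> piecewise_affine (\<lambda>x. vec_index (h x) j)"
    and i: "i < m"
  shows "piecewise_affine (\<lambda>x. vec_index (W *\<^sub>v h x - b) i)"
proof -
  have "vec_index (W *\<^sub>v h x - b) i = (\<Sum>j\<in>{0..<k}. W $$ (i, j) * vec_index (h x) j) + - vec_index b i" for x
    using W b i by (simp add: scalar_prod_def dim)
  then show ?thesis
    by (simp only:) (intro piecewise_affine_add piecewise_affine_sum piecewise_affine_cmult
        piecewise_affine_const h, simp)
qed

lemma piecewise_affine_network:
  fixes v :: "'a::euclidean_space \<Rightarrow> real"
  assumes "v \<in> relu_networks n L" "L \<ge> 1" "n 0 = DIM('a)" "n L = 1"
  shows "piecewise_affine v"
proof -
  obtain W b where v: "v = network W b L"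
    and Wb: "\<And>l. l \<in> {1..L} \<Longrightarrow> W l \<in> carrier_mat (n l) (n (l - 1)) \<and> b l \<in> carrier_vec (n l)"
    using assms(1) unfolding relu_networks_def by blast
  \<comment> \<open>The dimension is carried along because the scalar product sums over the length
    of its vector argument. The range \<open>l < L\<close> leaves out the output layer, which has no
    activation.\<close>
  have hidden: "(\<forall>x::'a. dim_vec (hidden_layers W b l (coord_vec x)) = n l) \<and>
      (\<forall>i<n l. piecewise_affine (\<lambda>x::'a. vec_index (hidden_layers W b l (coord_vec x)) i))"
    if "l < L" for l
    using that
  proof (induction l)
    case 0
    then show ?case
      using assms(3) by (auto simp: coord_vec_def intro!: piecewise_affine_inner)
  next
    case (Suc l)
    then have IH: "\<And>x::'a. dim_vec (hidden_layers W b l (coord_vec x)) = n l"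
      "\<And>i. i < n l \<Longrightarrow> piecewise_affine (\<lambda>x::'a. vec_index (hidden_layers W b l (coord_vec x)) i)"
      by auto
    have c: "W (Suc l) \<in> carrier_mat (n (Suc l)) (n l)" "b (Suc l) \<in> carrier_vec (n (Suc l))"
      using Wb[of "Suc l"] Suc.prems by auto
    have "piecewise_affine (\<lambda>x::'a. vec_index (hidden_layers W b (Suc l) (coord_vec x)) i)"
      if "i < n (Suc l)" for i
      using piecewise_affine_max0[OF piecewise_affine_layer[OF c IH that]] c that by simp
    then show ?case
      using c by simp
  qed
  have "W L \<in> carrier_mat (n L) (n (L - 1))" "b L \<in> carrier_vec (n L)"
    using Wb[of L] assms(2) by auto
  from piecewise_affine_layer[OF this, of "\<lambda>x. hidden_layers W b (L - 1) (coord_vec x)" 0]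
  show ?thesis
    unfolding v network_def[abs_def] using hidden[of "L - 1"] assms(2,4) by auto
qed

text \<open>\<open>G e\<close> is defined through the limit of difference quotients, not as the
  slope of a selected piece: a limit of Borel functions is Borel measurable without any selection.
  On the exceptional set \<open>lim\<close> has an unspecified value, which the almost everywhere
  claims do not see.\<close>

lemma piecewise_affine_directional_derivative:
  fixes v :: "'a::euclidean_space \<Rightarrow> real"
  assumes "piecewise_affine v"
  obtains K and G :: "'a \<Rightarrow> 'a \<Rightarrow> real" where "K-lipschitz_on UNIV v"
    "\<And>e. G e \<in> borel_measurable borel"
    "\<And>e. AE x in lborel. (\<lambda>n. (v (x - step n *\<^sub>R e) - v x) / step n) \<longlonglongrightarrow> - G e x"
    "\<And>e. norm e \<le> 1 \<Longrightarrow> AE x in lborel. \<bar>G e x\<bar> \<le> K"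
proof -
  obtain K A N where v: "K-lipschitz_on UNIV v" "finite A" "negligible N"
    "\<And>x. x \<notin> N \<Longrightarrow> \<exists>(a, c)\<in>A. \<forall>\<^sub>F y in nhds x. v y = inner a y + c"
    using assms by (rule piecewise_affineE) blast
  note [measurable] = borel_measurable_continuous_onI[OF lipschitz_on_continuous_on[OF v(1)]]
  define P where "P e n x = (v (x - step n *\<^sub>R e) - v x) / step n" for e n x
  define G where "G e x = - lim (\<lambda>n. P e n x)" for e x
  have [measurable]: "P e n \<in> borel_measurable borel" for e n
    unfolding P_def by measurable
  have conv: "(\<lambda>n. P e n x) \<longlonglongrightarrow> - G e x" if "x \<notin> N" for e x
  proof -
    obtain a c where *: "\<forall>\<^sub>F y in nhds x. v y = inner a y + c"
      using v(4)[OF \<open>x \<notin> N\<close>] by blast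
    have "((\<lambda>y. inner a y + c) has_derivative (\<lambda>h. inner a h)) (at x)"
      by (auto intro!: derivative_eq_intros)
    then have "(v has_derivative (\<lambda>h. inner a h)) (at x)"
      by (rule has_derivative_transform_eventually[OF _ eventually_mono[OF *[THEN filter_leD[OF at_within_le_nhds]]]]) (use eventually_nhds_x_imp_x[OF *] in auto)
    \<comment> \<open>Backward quotients in direction e are forward quotients in direction - e.
      Their limit is - inner a e, so \<open>G e x\<close> is the slope of the local piece in
      direction e.\<close>
    from directional_limit[OF this, of "- e"] have "(\<lambda>n. P e n x) \<longlonglongrightarrow> inner a (- e)"
      by (simp add: P_def)
    then show ?thesis
      using limI[of "\<lambda>n. P e n x"] by (simp add: G_def)
  qed
  have AE_N: "AE x in lborel. x \<notin> N"
    using v(3) AE_completion_iff[of "\<lambda>x. x \<notin> N" lborel] by (simp add: negligible_iff_null_sets AE_not_in)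
  show ?thesis
  proof
    show "K-lipschitz_on UNIV v" by fact
    show "G e \<in> borel_measurable borel" for e
      unfolding G_def by measurable
    show "AE x in lborel. (\<lambda>n. (v (x - step n *\<^sub>R e) - v x) / step n) \<longlonglongrightarrow> - G e x" for e
      using AE_N unfolding P_def[symmetric] by eventually_elim (rule conv)
    show "AE x in lborel. \<bar>G e x\<bar> \<le> K" if e: "norm e \<le> 1" for e
      using AE_N
    proof eventually_elim
      case (elim x)
      have "\<bar>P e n x\<bar> \<le> K" for n
      proof -
        have "\<bar>v (x - step n *\<^sub>R e) - v x\<bar> \<le> K * (step n * norm e)"
          using lipschitz_onD[OF v(1), of "x - step n *\<^sub>R e" x] by (simp add: dist_norm)
        also have "\<dots> \<le> K * step n"
          using e lipschitz_on_nonneg[OF v(1)] by (intro mult_left_mono) (simp_all add: mult_left_le)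
        finally show ?thesis
          unfolding P_def abs_divide by (simp add: pos_divide_le_eq del: of_nat_Suc)
      qed
      then have "\<bar>- G e x\<bar> \<le> K"
        by (intro LIMSEQ_le_const2[OF tendsto_rabs[OF conv[OF elim]]]) auto
      then show ?case by simp
    qed
  qed
qed

text \<open>The candidate is the inner product of \<beta> with the almost everywhere gradient. The
  field \<phi>\<beta> vanishes near the boundary, hence is differentiable on the whole space with
  bounded derivative, and each component can be integrated by parts in its own coordinate
  direction.\<close>

lemma piecewise_affine_in_V_space:
  fixes \<Omega> :: "'a::euclidean_space set"
  assumes \<Omega>: "open \<Omega>" "bounded \<Omega>" and \<beta>: "C1_closure \<Omega> \<beta>" and v: "piecewise_affine v"
  shows "v \<in> V_space \<Omega> \<beta>"
proof -
  obtain K and G :: "'a \<Rightarrow> 'a \<Rightarrow> real" where K: "K-lipschitz_on UNIV v"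
    and [measurable]: "\<And>e. G e \<in> borel_measurable borel"
    and lim: "\<And>e. AE x in lborel. (\<lambda>n. (v (x - step n *\<^sub>R e) - v x) / step n) \<longlonglongrightarrow> - G e x"
    and bound: "\<And>e. norm e \<le> 1 \<Longrightarrow> AE x in lborel. \<bar>G e x\<bar> \<le> K"
    using piecewise_affine_directional_derivative[OF v] by blast
  have sets: "\<Omega> \<in> sets lebesgue" "\<Omega> \<inter> space lebesgue \<in> sets lebesgue"
    using \<Omega> by auto
  have fin: "finite_measure (lebesgue_on \<Omega>)"
    using \<Omega> by (intro finite_measure_lebesgue_on bounded_set_imp_lmeasurable) auto
  have meas: "f \<in> borel_measurable (lebesgue_on \<Omega>)" if "f \<in> borel_measurable borel" for f :: "'a \<Rightarrow> real"
    using that by (intro measurable_restrict_space1 measurable_completion) simp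
  have contv: "continuous_on UNIV v"
    using K by (rule lipschitz_on_continuous_on)
  note [measurable] = borel_measurable_continuous_onI[OF contv]
  have sqv: "square_integrable (lebesgue_on \<Omega>) v"
  proof -
    have "bounded (v ` closure \<Omega>)"
      using \<Omega> contv by (intro compact_imp_bounded compact_continuous_image)
        (auto intro: continuous_on_subset)
    then obtain C where "\<And>x. x \<in> \<Omega> \<Longrightarrow> \<bar>v x\<bar> \<le> C"
      using closure_subset[of \<Omega>] by (auto simp: bounded_iff)
    then show ?thesis
      by (intro square_integrable_bounded[OF fin meas, where C = C]) auto
  qed
  have \<beta>comp: "C1_closure \<Omega> (\<lambda>x. inner (\<beta> x) b)" for b
    by (rule C1_closure_inner_left[OF \<beta>])
  define w where "w x = (\<Sum>b\<in>Basis. inner (\<beta> x) b * G b x)" for x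
  have sqw: "square_integrable (lebesgue_on \<Omega>) w"
  proof -
    have comp: "square_integrable (lebesgue_on \<Omega>) (\<lambda>x. inner (\<beta> x) b * G b x)" if "b \<in> Basis" for b
    proof -
      obtain C where C: "\<And>x. x \<in> closure \<Omega> \<Longrightarrow> norm (inner (\<beta> x) b) \<le> C"
        using C1_closure_bounded[OF \<Omega>(2) \<beta>comp] by blast
      have "AE x in lebesgue_on \<Omega>. \<bar>G b x\<bar> \<le> K"
        using AE_completion[OF bound[of b]] that sets
        by (auto simp: AE_restrict_space_iff elim!: eventually_mono)
      then have "square_integrable (lebesgue_on \<Omega>) (G b)"
        by (intro square_integrable_bounded[OF fin meas, where C = K]) auto
      moreover have "(\<lambda>x. inner (\<beta> x) b) \<in> borel_measurable (lebesgue_on \<Omega>)"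
        using \<beta>comp[of b] closure_subset[of \<Omega>] sets(1)
        by (intro continuous_imp_measurable_on_sets_lebesgue) (auto simp: C1_closure_def intro: continuous_on_subset)
      moreover have "AE x in lebesgue_on \<Omega>. \<bar>inner (\<beta> x) b\<bar> \<le> C"
        using C closure_subset[of \<Omega>] by (intro AE_I2) auto
      ultimately show ?thesis
        by (rule square_integrable_bounded_mult)
    qed
    have "square_integrable (lebesgue_on \<Omega>) (\<lambda>x. \<Sum>b\<in>B. inner (\<beta> x) b * G b x)" if "B \<subseteq> Basis" for B
      using finite_subset[OF that finite_Basis] that
    proof (induction B rule: finite_induct)
      case empty
      show ?case by (simp add: square_integrable_def)
    next
      case (insert b B)
      then show ?case
        using square_integrable_add[OF comp[of b]] by simp
    qed
    then show ?thesis unfolding w_def by simp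
  qed
  have parts: "(\<integral>x. w x * \<phi> x \<partial>lebesgue_on \<Omega>) =
      - (\<integral>x. v x * divergence (\<lambda>y. \<phi> y *\<^sub>R \<beta> y) x \<partial>lebesgue_on \<Omega>)"
    if \<phi>: "test_function \<Omega> \<phi>" for \<phi>
  proof -
    define S where "S = closure {x. \<phi> x \<noteq> 0}"
    have S: "compact S" "S \<subseteq> \<Omega>" "\<And>x. x \<notin> S \<Longrightarrow> \<phi> x = 0" "C1_closure \<Omega> \<phi>"
      using \<phi> closure_subset[of "{x. \<phi> x \<noteq> 0}"] C1_closure_UNIV[of \<phi> \<Omega>]
      by (auto simp: S_def test_function_def)
    obtain R where R: "\<And>x. x \<in> S \<Longrightarrow> norm x < R"
      using compact_imp_bounded[OF S(1)] by (auto simp: bounded_pos_less)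
    define F where "F y = \<phi> y *\<^sub>R \<beta> y" for y
    obtain E where E: "continuous_on (closure \<Omega>) E"
      "\<And>x. x \<in> \<Omega> \<Longrightarrow> (F has_derivative blinfun_apply (E x)) (at x)"
      using C1_closure_scaleR[OF S(4) \<beta>] unfolding F_def by (rule C1_closureE) blast
    \<comment> \<open>\<beta> is arbitrary outside the domain, but \<phi> vanishes on the open
      complement of its support, so \<phi>\<beta> has derivative 0 there.\<close>
    define D where "D x = (if x \<in> \<Omega> then E x else 0)" for x
    have D: "(F has_derivative blinfun_apply (D x)) (at x)" for x
    proof (cases "x \<in> \<Omega>")
      case True
      then show ?thesis by (simp add: D_def E)
    next
      case False
      have "((\<lambda>_. 0) has_derivative (\<lambda>_. 0)) (at x)"
        by (rule has_derivative_const)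
      then have "(F has_derivative (\<lambda>_. 0)) (at x)"
        by (rule has_derivative_transform_within_open[OF _ open_Compl[OF compact_imp_closed[OF S(1)]]])
          (use S False in \<open>auto simp: F_def\<close>)
      then show ?thesis
        using False by (simp add: D_def zero_blinfun.rep_eq)
    qed
    have "bounded (E ` closure \<Omega>)"
      using \<Omega> E(1) by (intro compact_imp_bounded compact_continuous_image) auto
    then obtain C where C: "0 < C" "\<And>x. x \<in> closure \<Omega> \<Longrightarrow> norm (E x) \<le> C"
      by (auto simp: bounded_pos)
    have "norm (D x) \<le> C" for x
      using C closure_subset[of \<Omega>] by (auto simp: D_def)
    \<comment> \<open>The mean value inequality runs along segments, which may leave the domain;
      this is what the globally defined derivative \<open>D\<close> is for.\<close>
    then have lipF: "norm (F x - F y) \<le> C * norm (x - y)" for x y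
      using D by (intro differentiable_bound[of UNIV F "\<lambda>x. blinfun_apply (D x)"])
        (auto simp: norm_blinfun.rep_eq)
    have ibp: "integrable lborel (\<lambda>x. v x * inner (D x b) b)"
      "integrable lborel (\<lambda>x. G b x * inner (F x) b)"
      "(\<integral>x. v x * inner (D x b) b \<partial>lborel) = - (\<integral>x. G b x * inner (F x) b \<partial>lborel)"
      if b: "b \<in> Basis" for b
    proof -
      have der: "((\<lambda>x. inner (F x) b) has_derivative (\<lambda>h. inner (D x h) b)) (at x)" for x
        by (rule bounded_linear.has_derivative[OF bounded_linear_inner_left D])
      have lip: "C-lipschitz_on UNIV (\<lambda>x. inner (F x) b)"
      proof (rule lipschitz_onI)
        show "dist (inner (F x) b) (inner (F y) b) \<le> C * dist x y" for x y
          using Basis_le_norm[OF b, of "F x - F y"] lipF[of x y]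
          by (simp add: dist_norm inner_diff_left)
      qed (use C in simp)
      have supp: "inner (F x) b = 0" if "R \<le> norm x" for x
        using that R[of x] S(3)[of x] by (auto simp: F_def)
      note * = lborel_integral_by_parts[OF der lip supp K _ _ lim, of R b]
      show "integrable lborel (\<lambda>x. v x * inner (D x b) b)"
        "integrable lborel (\<lambda>x. G b x * inner (F x) b)"
        "(\<integral>x. v x * inner (D x b) b \<partial>lborel) = - (\<integral>x. G b x * inner (F x) b \<partial>lborel)"
        using * b by simp_all
    qed
    have div: "divergence F x = (\<Sum>b\<in>Basis. inner (D x b) b)" for x
      by (rule divergence_eq[OF D])
    have conv: "(\<integral>x. p x \<partial>lebesgue_on \<Omega>) = (\<integral>x. q x \<partial>lborel)"
      if "integrable lborel q" "\<And>x. x \<in> \<Omega> \<Longrightarrow> p x = q x" "\<And>x. x \<notin> \<Omega> \<Longrightarrow> q x = 0" for p q :: "'a \<Rightarrow> real"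
    proof -
      have "(\<integral>x. p x \<partial>lebesgue_on \<Omega>) = (\<integral>x. indicator \<Omega> x *\<^sub>R p x \<partial>lebesgue)"
        using sets by (intro integral_restrict_space) auto
      also have "(\<lambda>x. indicator \<Omega> x *\<^sub>R p x) = q"
        using that(2,3) by (auto simp: indicator_def fun_eq_iff)
      also have "(\<integral>x. q x \<partial>lebesgue) = (\<integral>x. q x \<partial>lborel)"
        using that(1) by (intro integral_completion) auto
      finally show ?thesis .
    qed
    have "(\<integral>x. v x * divergence F x \<partial>lebesgue_on \<Omega>) = (\<integral>x. (\<Sum>b\<in>Basis. v x * inner (D x b) b) \<partial>lborel)"
    proof (rule conv)
      show "integrable lborel (\<lambda>x. \<Sum>b\<in>Basis. v x * inner (D x b) b)"
        by (intro Bochner_Integration.integrable_sum ibp)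
      show "(\<Sum>b\<in>Basis. v x * inner (D x b) b) = 0" if "x \<notin> \<Omega>" for x
        using that by (simp add: D_def zero_blinfun.rep_eq)
    qed (simp add: div sum_distrib_left)
    also have "\<dots> = (\<Sum>b\<in>Basis. \<integral>x. v x * inner (D x b) b \<partial>lborel)"
      by (intro Bochner_Integration.integral_sum ibp)
    also have "\<dots> = - (\<Sum>b\<in>Basis. \<integral>x. G b x * inner (F x) b \<partial>lborel)"
      by (simp add: ibp(3) sum_negf)
    also have "(\<Sum>b\<in>Basis. \<integral>x. G b x * inner (F x) b \<partial>lborel) = (\<integral>x. (\<Sum>b\<in>Basis. G b x * inner (F x) b) \<partial>lborel)"
      by (intro Bochner_Integration.integral_sum[symmetric] ibp)
    also have "\<dots> = (\<integral>x. w x * \<phi> x \<partial>lebesgue_on \<Omega>)"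
    proof (rule conv[symmetric])
      show "integrable lborel (\<lambda>x. \<Sum>b\<in>Basis. G b x * inner (F x) b)"
        by (intro Bochner_Integration.integrable_sum ibp)
      show "w x * \<phi> x = (\<Sum>b\<in>Basis. G b x * inner (F x) b)" for x
        by (simp add: w_def F_def sum_distrib_left ac_simps)
      show "(\<Sum>b\<in>Basis. G b x * inner (F x) b) = 0" if "x \<notin> \<Omega>" for x
        using that S(2,3) by (intro sum.neutral) (auto simp: F_def)
    qed
    finally show ?thesis
      by (simp add: F_def[abs_def])
  qed
  have "is_adv_deriv \<Omega> \<beta> v w"
    unfolding is_adv_deriv_def using sqw parts by blast
  then show ?thesis
    unfolding V_space_def using sqv by blast
qed

section \<open>Uniqueness and linearity of weak derivatives and traces\<close>

locale flow_domain =
  fixes \<Omega> :: "'a::euclidean_space set" and \<beta> \<nu> :: "'a \<Rightarrow> 'a"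
  assumes open_domain: "open \<Omega>" and bounded_domain: "bounded \<Omega>"
    and C1_field: "C1_closure \<Omega> \<beta>"
    and normal: "outward_unit_normal \<Omega> \<nu>"
begin

section \<open>Measurability and integrability in the domain and on its boundary\<close>

lemma domain_sets: "\<Omega> \<in> sets lebesgue"
  using open_domain by auto

lemma finite_measure_domain: "finite_measure (lebesgue_on \<Omega>)"
  using open_domain bounded_domain
  by (intro finite_measure_lebesgue_on bounded_set_imp_lmeasurable) auto

lemma borel_measurable_domain:
  "continuous_on \<Omega> f \<Longrightarrow> f \<in> borel_measurable (lebesgue_on \<Omega>)" for f :: "'a \<Rightarrow> real"
  by (rule continuous_imp_measurable_on_sets_lebesgue[OF _ domain_sets])

text \<open>\<open>measure_of\<close> keeps the sigma-algebra it is given, for any set function, so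
  measurability on the boundary is Borel measurability on the frontier.\<close>

lemma sets_surface_measure: "sets (surface_measure \<Omega>) = sets (restrict_space borel (frontier \<Omega>))"
proof -
  have "sets (hausdorff_measure k :: 'a measure) = sets borel" for k
    by (simp add: hausdorff_measure_def sets.sigma_sets_eq[of borel, simplified])
  then show ?thesis
    unfolding surface_measure_def by (rule sets_restrict_space_cong)
qed

lemma space_surface_measure: "space (surface_measure \<Omega>) = frontier \<Omega>"
  using sets_eq_imp_space_eq[OF sets_surface_measure] by (simp add: space_restrict_space)

lemma borel_measurable_surface:
  assumes "continuous_on (closure \<Omega>) f"
  shows "f \<in> borel_measurable (surface_measure \<Omega>)"
proof -
  have "continuous_on (frontier \<Omega>) f"
    by (rule continuous_on_subset[OF assms]) (auto simp: frontier_def)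
  then have "f \<in> borel_measurable (restrict_space borel (frontier \<Omega>))"
    by (rule borel_measurable_continuous_on_restrict)
  then show ?thesis
    unfolding measurable_cong_sets[OF sets_surface_measure refl] .
qed

lemma identity_measurable_surface: "(\<lambda>x. x) \<in> borel_measurable (surface_measure \<Omega>)"
  by (rule borel_measurable_surface) (rule continuous_on_id)

lemma normal_component_measurable [measurable]:
  "(\<lambda>x. inner (\<beta> x) (\<nu> x)) \<in> borel_measurable (surface_measure \<Omega>)"
proof (rule borel_measurable_inner)
  show "\<beta> \<in> borel_measurable (surface_measure \<Omega>)"
    using C1_field by (intro borel_measurable_surface) (simp add: C1_closure_def)
  show "\<nu> \<in> borel_measurable (surface_measure \<Omega>)"
    using normal by (simp add: outward_unit_normal_def)
qed

text \<open>The normal has unit length only almost everywhere, hence the exceptional set; \<beta> is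
  bounded as a continuous field on the compact closure.\<close>

lemma normal_component_bounded:
  obtains C where "AE x in surface_measure \<Omega>. \<bar>inner (\<beta> x) (\<nu> x)\<bar> \<le> C"
proof -
  obtain C where C: "\<And>x. x \<in> closure \<Omega> \<Longrightarrow> norm (\<beta> x) \<le> C"
    using C1_closure_bounded[OF bounded_domain C1_field] by blast
  have "AE x in surface_measure \<Omega>. is_outward_normal_at \<Omega> x (\<nu> x)"
    using normal by (simp add: outward_unit_normal_def)
  then have "AE x in surface_measure \<Omega>. \<bar>inner (\<beta> x) (\<nu> x)\<bar> \<le> C"
    using AE_space
  proof eventually_elim
    case (elim x)
    then have "\<bar>inner (\<beta> x) (\<nu> x)\<bar> \<le> norm (\<beta> x)"
      using Cauchy_Schwarz_ineq2[of "\<beta> x" "\<nu> x"] by (simp add: is_outward_normal_at_def)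
    also have "\<dots> \<le> C"
      using elim by (intro C) (auto simp: space_surface_measure frontier_def)
    finally show ?case .
  qed
  then show ?thesis by (rule that)
qed

lemma inflow_boundary_sets: "inflow_boundary \<Omega> \<beta> \<nu> \<in> sets (surface_measure \<Omega>)"
proof -
  have "{x \<in> space (surface_measure \<Omega>). inner (\<beta> x) (\<nu> x) < 0} \<in> sets (surface_measure \<Omega>)"
    by measurable
  then show ?thesis
    by (simp add: inflow_boundary_def space_surface_measure)
qed

text \<open>The integral of a nonintegrable function is 0 by convention, so identities between
  integrals can be added only once each term is integrable. These two facts cover the volume terms
  in the definitions of weak derivative and trace.\<close>

lemma integrable_mult_test:
  assumes "square_integrable (lebesgue_on \<Omega>) v" "C1_closure \<Omega> \<phi>"
  shows "integrable (lebesgue_on \<Omega>) (\<lambda>x. v x * \<phi> x)"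
    "integrable (lebesgue_on \<Omega>) (\<lambda>x. v x * divergence (\<lambda>y. \<phi> y *\<^sub>R \<beta> y) x)"
proof -
  obtain C where C: "\<And>x. x \<in> closure \<Omega> \<Longrightarrow> norm (\<phi> x) \<le> C"
    using C1_closure_bounded[OF bounded_domain assms(2)] by blast
  have "square_integrable (lebesgue_on \<Omega>) \<phi>"
  proof (rule square_integrable_bounded[OF finite_measure_domain])
    show "\<phi> \<in> borel_measurable (lebesgue_on \<Omega>)"
      using assms(2) closure_subset[of \<Omega>]
      by (intro borel_measurable_domain) (auto simp: C1_closure_def intro: continuous_on_subset)
    show "AE x in lebesgue_on \<Omega>. \<bar>\<phi> x\<bar> \<le> C"
      using C closure_subset[of \<Omega>] by (intro AE_I2) auto
  qed
  then show "integrable (lebesgue_on \<Omega>) (\<lambda>x. v x * \<phi> x)"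
    by (rule square_integrable_mult[OF assms(1)])
  obtain C' where C': "\<And>x. x \<in> \<Omega> \<Longrightarrow> \<bar>divergence (\<lambda>y. \<phi> y *\<^sub>R \<beta> y) x\<bar> \<le> C'"
    "continuous_on \<Omega> (divergence (\<lambda>y. \<phi> y *\<^sub>R \<beta> y))"
    using C1_closure_divergence[OF bounded_domain C1_closure_scaleR[OF assms(2) C1_field]] by blast
  have "square_integrable (lebesgue_on \<Omega>) (divergence (\<lambda>y. \<phi> y *\<^sub>R \<beta> y))"
    using C' by (intro square_integrable_bounded[OF finite_measure_domain, where C = C']
        borel_measurable_domain AE_I2) auto
  then show "integrable (lebesgue_on \<Omega>) (\<lambda>x. v x * divergence (\<lambda>y. \<phi> y *\<^sub>R \<beta> y) x)"
    by (rule square_integrable_mult[OF assms(1)])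
qed

section \<open>Weak directional derivatives\<close>

lemma test_function_C1: "test_function \<Omega> \<phi> \<Longrightarrow> C1_closure \<Omega> \<phi>"
  using C1_closure_UNIV by (auto simp: test_function_def)

lemma V_space_square_integrable: "v \<in> V_space \<Omega> \<beta> \<Longrightarrow> square_integrable (lebesgue_on \<Omega>) v"
  by (simp add: V_space_def)

lemma is_adv_deriv_adv_deriv: "v \<in> V_space \<Omega> \<beta> \<Longrightarrow> is_adv_deriv \<Omega> \<beta> v (adv_deriv \<Omega> \<beta> v)"
  unfolding adv_deriv_def V_space_def by (auto intro: someI[of "is_adv_deriv \<Omega> \<beta> v"])

lemma adv_deriv_square_integrable:
  "v \<in> V_space \<Omega> \<beta> \<Longrightarrow> square_integrable (lebesgue_on \<Omega>) (adv_deriv \<Omega> \<beta> v)"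
  using is_adv_deriv_adv_deriv by (auto simp: is_adv_deriv_def)

lemma is_adv_deriv_unique:
  assumes "is_adv_deriv \<Omega> \<beta> v w" "is_adv_deriv \<Omega> \<beta> v w'"
  shows "AE x in lebesgue_on \<Omega>. w x = w' x"
proof -
  have sq: "square_integrable (lebesgue_on \<Omega>) w" "square_integrable (lebesgue_on \<Omega>) w'"
    using assms by (auto simp: is_adv_deriv_def)
  have "AE x in lebesgue_on \<Omega>. w x - w' x = 0"
  proof (rule AE_zero_if_test_integrals_zero[OF open_domain bounded_domain square_integrable_diff[OF sq]])
    fix \<phi> assume \<phi>: "test_function \<Omega> \<phi>"
    have "(\<integral>x. w x * \<phi> x \<partial>lebesgue_on \<Omega>) = (\<integral>x. w' x * \<phi> x \<partial>lebesgue_on \<Omega>)"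
      using assms \<phi> by (simp add: is_adv_deriv_def)
    then show "(\<integral>x. (w x - w' x) * \<phi> x \<partial>lebesgue_on \<Omega>) = 0"
      using integrable_mult_test(1)[OF sq(1) test_function_C1[OF \<phi>]]
        integrable_mult_test(1)[OF sq(2) test_function_C1[OF \<phi>]]
      by (simp add: left_diff_distrib)
  qed
  then show ?thesis by simp
qed

text \<open>A single form of combination suffices: r = -1 gives differences, and variable r gives
  the lines along which the functional is minimized.\<close>

lemma is_adv_deriv_linear:
  assumes "square_integrable (lebesgue_on \<Omega>) v" "square_integrable (lebesgue_on \<Omega>) w"
    and "is_adv_deriv \<Omega> \<beta> v v'" "is_adv_deriv \<Omega> \<beta> w w'"
  shows "is_adv_deriv \<Omega> \<beta> (\<lambda>x. v x + r * w x) (\<lambda>x. v' x + r * w' x)"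
  unfolding is_adv_deriv_def
proof (intro conjI allI impI)
  have sq: "square_integrable (lebesgue_on \<Omega>) v'" "square_integrable (lebesgue_on \<Omega>) w'"
    using assms by (auto simp: is_adv_deriv_def)
  then show "square_integrable (lebesgue_on \<Omega>) (\<lambda>x. v' x + r * w' x)"
    by (intro square_integrable_add square_integrable_cmult)
  fix \<phi> assume \<phi>: "test_function \<Omega> \<phi>"
  note C1 = test_function_C1[OF \<phi>]
  note int = integrable_mult_test(1)[OF sq(1) C1] integrable_mult_test(1)[OF sq(2) C1]
    integrable_mult_test(2)[OF assms(1) C1] integrable_mult_test(2)[OF assms(2) C1]
  have eq: "(\<integral>x. v' x * \<phi> x \<partial>lebesgue_on \<Omega>) = - (\<integral>x. v x * divergence (\<lambda>y. \<phi> y *\<^sub>R \<beta> y) x \<partial>lebesgue_on \<Omega>)"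
    "(\<integral>x. w' x * \<phi> x \<partial>lebesgue_on \<Omega>) = - (\<integral>x. w x * divergence (\<lambda>y. \<phi> y *\<^sub>R \<beta> y) x \<partial>lebesgue_on \<Omega>)"
    using assms \<phi> by (auto simp: is_adv_deriv_def)
  show "(\<integral>x. (v' x + r * w' x) * \<phi> x \<partial>lebesgue_on \<Omega>) =
      - (\<integral>x. (v x + r * w x) * divergence (\<lambda>y. \<phi> y *\<^sub>R \<beta> y) x \<partial>lebesgue_on \<Omega>)"
    using int by (simp add: distrib_right mult.assoc eq)
qed

lemma V_space_linear:
  assumes "v \<in> V_space \<Omega> \<beta>" "w \<in> V_space \<Omega> \<beta>"
  shows "(\<lambda>x. v x + r * w x) \<in> V_space \<Omega> \<beta>"
  using is_adv_deriv_linear[OF assms[THEN V_space_square_integrable] assms[THEN is_adv_deriv_adv_deriv]]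
    square_integrable_add[OF V_space_square_integrable[OF assms(1)]
      square_integrable_cmult[OF V_space_square_integrable[OF assms(2)]]]
  unfolding V_space_def by blast

lemma adv_deriv_linear:
  assumes "v \<in> V_space \<Omega> \<beta>" "w \<in> V_space \<Omega> \<beta>"
  shows "AE x in lebesgue_on \<Omega>.
    adv_deriv \<Omega> \<beta> (\<lambda>x. v x + r * w x) x = adv_deriv \<Omega> \<beta> v x + r * adv_deriv \<Omega> \<beta> w x"
  by (rule is_adv_deriv_unique[OF is_adv_deriv_adv_deriv[OF V_space_linear[OF assms]]
        is_adv_deriv_linear[OF assms[THEN V_space_square_integrable] assms[THEN is_adv_deriv_adv_deriv]]])

section \<open>Boundary traces\<close>

lemma is_trace_integrable:
  assumes "is_trace \<Omega> \<beta> \<nu> v t" "C1_closure \<Omega> \<phi>"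
  shows "integrable (surface_measure \<Omega>) (\<lambda>x. inner (\<beta> x) (\<nu> x) * t x * \<phi> x)"
proof -
  obtain C where C: "\<And>x. x \<in> closure \<Omega> \<Longrightarrow> norm (\<phi> x) \<le> C"
    using C1_closure_bounded[OF bounded_domain assms(2)] by blast
  show ?thesis
  proof (rule integrable_bounded_mult)
    show "integrable (surface_measure \<Omega>) (\<lambda>x. inner (\<beta> x) (\<nu> x) * t x)"
      using assms(1) by (simp add: is_trace_def)
    show "\<phi> \<in> borel_measurable (surface_measure \<Omega>)"
      using assms(2) by (intro borel_measurable_surface) (simp add: C1_closure_def)
    show "\<bar>\<phi> x\<bar> \<le> C" if "x \<in> space (surface_measure \<Omega>)" for x
      using C[of x] that by (simp add: space_surface_measure frontier_def)
  qed
qed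

text \<open>Traces are tested with all functions that are C1 up to the boundary, so the bumps of
  every box are admissible, in contrast to the interior. The tests see \<open>t\<close> only through
  its product with the normal component, which is what they determine.\<close>

lemma is_trace_unique:
  assumes t: "is_trace \<Omega> \<beta> \<nu> v t" "is_trace \<Omega> \<beta> \<nu> v t'"
  shows "AE x in surface_measure \<Omega>. inner (\<beta> x) (\<nu> x) \<noteq> 0 \<longrightarrow> t x = t' x"
proof -
  define s where "s x = inner (\<beta> x) (\<nu> x) * t x - inner (\<beta> x) (\<nu> x) * t' x" for x
  have s: "integrable (surface_measure \<Omega>) s"
    using t unfolding s_def is_trace_def by (intro Bochner_Integration.integrable_diff) auto
  have "AE x in surface_measure \<Omega>. s x = 0"
  proof (rule AE_zero_if_box_integrals_zero[OF sets_surface_measure s])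
    fix a b :: 'a
    show "(\<integral>x. indicator (box a b) x * s x \<partial>surface_measure \<Omega>) = 0"
    proof (rule integral_indicator_box_eq_0[OF s identity_measurable_surface])
      fix \<phi> :: "'a \<Rightarrow> real" assume "C1_closure UNIV \<phi>"
      then have \<phi>: "C1_closure \<Omega> \<phi>" by (rule C1_closure_UNIV)
      have "(\<integral>x. inner (\<beta> x) (\<nu> x) * t x * \<phi> x \<partial>surface_measure \<Omega>) =
          (\<integral>x. inner (\<beta> x) (\<nu> x) * t' x * \<phi> x \<partial>surface_measure \<Omega>)"
        using t \<phi> by (simp add: is_trace_def)
      then show "(\<integral>x. s x * \<phi> x \<partial>surface_measure \<Omega>) = 0"
        using is_trace_integrable[OF t(1) \<phi>] is_trace_integrable[OF t(2) \<phi>]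
        by (simp add: s_def left_diff_distrib)
    qed
  qed
  then show ?thesis
    by eventually_elim (auto simp: s_def)
qed

text \<open>Green's formula for v + r w contains its chosen derivative, which agrees with the
  combination of the chosen derivatives of v and w only almost everywhere; here the uniqueness of
  weak derivatives enters.\<close>

lemma is_trace_linear:
  assumes vw: "v \<in> V_space \<Omega> \<beta>" "w \<in> V_space \<Omega> \<beta>"
    and t: "is_trace \<Omega> \<beta> \<nu> v t" "is_trace \<Omega> \<beta> \<nu> w t'"
  shows "is_trace \<Omega> \<beta> \<nu> (\<lambda>x. v x + r * w x) (\<lambda>x. t x + r * t' x)"
  unfolding is_trace_def
proof (intro conjI allI impI)
  have [measurable]: "t \<in> borel_measurable (surface_measure \<Omega>)" "t' \<in> borel_measurable (surface_measure \<Omega>)"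
    using t by (auto simp: is_trace_def)
  show "(\<lambda>x. t x + r * t' x) \<in> borel_measurable (surface_measure \<Omega>)"
    by measurable
  have "integrable (surface_measure \<Omega>) (\<lambda>x. inner (\<beta> x) (\<nu> x) * t x + r * (inner (\<beta> x) (\<nu> x) * t' x))"
    using t unfolding is_trace_def
    by (intro Bochner_Integration.integrable_add integrable_mult_right) auto
  then show "integrable (surface_measure \<Omega>) (\<lambda>x. inner (\<beta> x) (\<nu> x) * (t x + r * t' x))"
    by (simp add: distrib_left mult.left_commute)
  fix \<phi> :: "'a \<Rightarrow> real" assume \<phi>: "C1_closure \<Omega> \<phi>"
  let ?B = "\<lambda>t. \<integral>x. inner (\<beta> x) (\<nu> x) * t x * \<phi> x \<partial>surface_measure \<Omega>"
  let ?A = "\<lambda>v'. \<integral>x. v' x * \<phi> x \<partial>lebesgue_on \<Omega>"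
  let ?D = "\<lambda>v. \<integral>x. v x * divergence (\<lambda>y. \<phi> y *\<^sub>R \<beta> y) x \<partial>lebesgue_on \<Omega>"
  let ?adv = "adv_deriv \<Omega> \<beta>"
  have "?B (\<lambda>x. t x + r * t' x) = (\<integral>x. inner (\<beta> x) (\<nu> x) * t x * \<phi> x
      + r * (inner (\<beta> x) (\<nu> x) * t' x * \<phi> x) \<partial>surface_measure \<Omega>)"
    by (rule Bochner_Integration.integral_cong) (auto simp: algebra_simps)
  also have "\<dots> = ?B t + r * ?B t'"
    using is_trace_integrable[OF t(1) \<phi>] is_trace_integrable[OF t(2) \<phi>] by simp
  also have "\<dots> = (?A (?adv v) + ?D v) + r * (?A (?adv w) + ?D w)"
    using t \<phi> by (simp add: is_trace_def)
  also have "\<dots> = (?A (?adv v) + r * ?A (?adv w)) + (?D v + r * ?D w)"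
    by (simp add: algebra_simps)
  also have "?D v + r * ?D w = ?D (\<lambda>x. v x + r * w x)"
    using integrable_mult_test(2)[OF V_space_square_integrable[OF vw(1)] \<phi>]
      integrable_mult_test(2)[OF V_space_square_integrable[OF vw(2)] \<phi>]
    by (simp add: distrib_right mult.assoc)
  also have "?A (?adv v) + r * ?A (?adv w) = ?A (\<lambda>x. ?adv v x + r * ?adv w x)"
    using integrable_mult_test(1)[OF adv_deriv_square_integrable[OF vw(1)] \<phi>]
      integrable_mult_test(1)[OF adv_deriv_square_integrable[OF vw(2)] \<phi>]
    by (simp add: distrib_right mult.assoc)
  also have "\<dots> = ?A (?adv (\<lambda>x. v x + r * w x))"
  proof (rule integral_cong_AE)
    note sq = adv_deriv_square_integrable[OF vw(1)] adv_deriv_square_integrable[OF vw(2)]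
      adv_deriv_square_integrable[OF V_space_linear[OF vw, of r]]
    have [measurable]: "\<phi> \<in> borel_measurable (lebesgue_on \<Omega>)"
      using \<phi> closure_subset[of \<Omega>]
      by (intro borel_measurable_domain) (auto simp: C1_closure_def intro: continuous_on_subset)
    note [measurable] = sq[THEN square_integrable_measurable]
    show "(\<lambda>x. (?adv v x + r * ?adv w x) * \<phi> x) \<in> borel_measurable (lebesgue_on \<Omega>)"
      "(\<lambda>x. ?adv (\<lambda>x. v x + r * w x) x * \<phi> x) \<in> borel_measurable (lebesgue_on \<Omega>)"
      by measurable
    show "AE x in lebesgue_on \<Omega>. (?adv v x + r * ?adv w x) * \<phi> x = ?adv (\<lambda>x. v x + r * w x) x * \<phi> x"
      using adv_deriv_linear[OF vw, of r] by eventually_elim simp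
  qed
  finally show "?B (\<lambda>x. t x + r * t' x) = ?A (?adv (\<lambda>x. v x + r * w x)) + ?D (\<lambda>x. v x + r * w x)" .
qed

lemma is_trace_trace: "is_trace \<Omega> \<beta> \<nu> v t \<Longrightarrow> is_trace \<Omega> \<beta> \<nu> v (trace \<Omega> \<beta> \<nu> v)"
  unfolding trace_def by (rule someI[of "is_trace \<Omega> \<beta> \<nu> v"])

lemma trace_linear:
  assumes "v \<in> V_space \<Omega> \<beta>" "w \<in> V_space \<Omega> \<beta>" "is_trace \<Omega> \<beta> \<nu> v t" "is_trace \<Omega> \<beta> \<nu> w t'"
  shows "AE x in surface_measure \<Omega>. inner (\<beta> x) (\<nu> x) \<noteq> 0 \<longrightarrow>
    trace \<Omega> \<beta> \<nu> (\<lambda>x. v x + r * w x) x = trace \<Omega> \<beta> \<nu> v x + r * trace \<Omega> \<beta> \<nu> w x"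
proof -
  have lin: "is_trace \<Omega> \<beta> \<nu> (\<lambda>x. v x + r * w x) (\<lambda>x. trace \<Omega> \<beta> \<nu> v x + r * trace \<Omega> \<beta> \<nu> w x)"
    by (rule is_trace_linear[OF assms(1,2) assms(3,4)[THEN is_trace_trace]])
  show ?thesis
    by (rule is_trace_unique[OF is_trace_trace[OF lin] lin])
qed

end

section \<open>The least-squares functional along lines\<close>

lemma integral_square_expand:
  fixes p q :: "'b \<Rightarrow> real"
  assumes "square_integrable M p" "square_integrable M q"
  shows "(\<integral>x. (p x + r * q x)\<^sup>2 \<partial>M) =
    (\<integral>x. (p x)\<^sup>2 \<partial>M) + 2 * r * (\<integral>x. p x * q x \<partial>M) + r\<^sup>2 * (\<integral>x. (q x)\<^sup>2 \<partial>M)"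
proof -
  note int = square_integrable_integrable_sq[OF assms(1)] square_integrable_integrable_sq[OF assms(2)]
    square_integrable_mult[OF assms]
  have "(\<integral>x. (p x + r * q x)\<^sup>2 \<partial>M) = (\<integral>x. (p x)\<^sup>2 + 2 * r * (p x * q x) + r\<^sup>2 * (q x)\<^sup>2 \<partial>M)"
    by (rule Bochner_Integration.integral_cong) (auto simp: power2_eq_square algebra_simps)
  then show ?thesis
    using int by simp
qed

lemma quadratic_nonneg_imp_linear_zero:
  fixes b c :: real
  assumes "c \<ge> 0" "\<And>r. 2 * r * b + r\<^sup>2 * c \<ge> 0"
  shows "b = 0"
proof (rule ccontr)
  assume "b \<noteq> 0"
  \<comment> \<open>The critical point - b / c would be undefined for c = 0, so the denominator is
    raised by 1; at - t the polynomial equals - t^2 (c + 2), which is still negative.\<close>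
  define t where "t = b / (c + 1)"
  have b: "b = t * (c + 1)" "t \<noteq> 0"
    using \<open>b \<noteq> 0\<close> assms(1) by (auto simp: t_def)
  have "2 * (- t) * b + (- t)\<^sup>2 * c = - (t\<^sup>2 * (c + 2))"
    by (simp add: b(1) power2_eq_square algebra_simps)
  moreover have "t\<^sup>2 * (c + 2) > 0"
    using b(2) assms(1) by simp
  ultimately show False
    using assms(2)[of "- t"] by linarith
qed

context flow_domain
begin

definition residual :: "('a \<Rightarrow> real) \<Rightarrow> ('a \<Rightarrow> real) \<Rightarrow> 'a \<Rightarrow> real" where
  "residual \<gamma> v x = adv_deriv \<Omega> \<beta> v x + adjusted_coeff \<beta> \<gamma> x * v x"

text \<open>The root of the boundary weight, cut off to the inflow part, turns the weighted seminorm
  into an ordinary L2 norm over the whole frontier, so that \<open>integral_square_expand\<close>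
  handles volume and boundary terms alike. It is zero wherever the trace is undetermined.\<close>

definition inflow_weight :: "'a \<Rightarrow> real" where
  "inflow_weight x = indicator (inflow_boundary \<Omega> \<beta> \<nu>) x * sqrt \<bar>inner (\<beta> x) (\<nu> x)\<bar>"

lemma inflow_weight_measurable [measurable]: "inflow_weight \<in> borel_measurable (surface_measure \<Omega>)"
proof -
  note [measurable] = inflow_boundary_sets
  show ?thesis unfolding inflow_weight_def by measurable
qed

lemma ls_functional_eq:
  assumes "is_trace \<Omega> \<beta> \<nu> v t"
  shows "ls_functional \<Omega> \<beta> \<nu> \<gamma> f g v =
    (\<integral>\<^sup>+x. ennreal ((residual \<gamma> v x - f x)\<^sup>2) \<partial>lebesgue_on \<Omega>) +
    (\<integral>\<^sup>+x. ennreal ((inflow_weight x * (trace \<Omega> \<beta> \<nu> v x - g x))\<^sup>2) \<partial>surface_measure \<Omega>)"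
proof -
  have "inflow_norm_sq \<Omega> \<beta> \<nu> w =
      (\<integral>\<^sup>+x. ennreal ((inflow_weight x * w x)\<^sup>2) \<partial>surface_measure \<Omega>)" for w
    unfolding inflow_norm_sq_def
    by (rule nn_integral_cong) (auto simp: inflow_weight_def indicator_def power_mult_distrib)
  then show ?thesis
    using assms unfolding ls_functional_def residual_def by auto
qed

text \<open>The convention that the functional is infinite when there is no trace turns finiteness
  into existence. Finiteness itself will come from the norm equivalence.\<close>

lemma ls_functional_finite_imp_trace:
  "ls_functional \<Omega> \<beta> \<nu> \<gamma> f g v < \<infinity> \<Longrightarrow> is_trace \<Omega> \<beta> \<nu> v (trace \<Omega> \<beta> \<nu> v)"
  by (auto simp: ls_functional_def intro: is_trace_trace split: if_splits)

section \<open>Residuals and weighted boundary values as square integrable functions\<close>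

lemma residual_square_integrable:
  assumes "continuous_on (closure \<Omega>) \<gamma>" "v \<in> V_space \<Omega> \<beta>"
  shows "square_integrable (lebesgue_on \<Omega>) (residual \<gamma> v)"
proof -
  obtain C where C: "\<And>x. x \<in> \<Omega> \<Longrightarrow> \<bar>divergence \<beta> x\<bar> \<le> C" "continuous_on \<Omega> (divergence \<beta>)"
    using C1_closure_divergence[OF bounded_domain C1_field] by blast
  have "bounded (\<gamma> ` closure \<Omega>)"
    using assms(1) bounded_domain by (intro compact_imp_bounded compact_continuous_image) auto
  then obtain B where B: "\<And>x. x \<in> \<Omega> \<Longrightarrow> \<bar>\<gamma> x\<bar> \<le> B"
    using closure_subset[of \<Omega>] by (auto simp: bounded_iff)
  have "square_integrable (lebesgue_on \<Omega>) (\<lambda>x. adjusted_coeff \<beta> \<gamma> x * v x)"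
  proof (rule square_integrable_bounded_mult[OF V_space_square_integrable[OF assms(2)]])
    show "adjusted_coeff \<beta> \<gamma> \<in> borel_measurable (lebesgue_on \<Omega>)"
      unfolding adjusted_coeff_def
      by (intro borel_measurable_domain continuous_intros C(2) continuous_on_subset[OF assms(1)] closure_subset)
    show "AE x in lebesgue_on \<Omega>. \<bar>adjusted_coeff \<beta> \<gamma> x\<bar> \<le> B + C"
    proof (rule AE_I2)
      fix x assume "x \<in> space (lebesgue_on \<Omega>)"
      then have "x \<in> \<Omega>" by simp
      from B[OF this] C(1)[OF this] show "\<bar>adjusted_coeff \<beta> \<gamma> x\<bar> \<le> B + C"
        unfolding adjusted_coeff_def by linarith
    qed
  qed
  from square_integrable_add[OF adv_deriv_square_integrable[OF assms(2)] this] show ?thesis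
    unfolding residual_def .
qed

lemma residual_linear:
  assumes "v \<in> V_space \<Omega> \<beta>" "w \<in> V_space \<Omega> \<beta>"
  shows "AE x in lebesgue_on \<Omega>. residual \<gamma> (\<lambda>x. v x + r * w x) x = residual \<gamma> v x + r * residual \<gamma> w x"
  using adv_deriv_linear[OF assms, of r]
  by eventually_elim (simp add: residual_def algebra_simps)

lemma weighted_trace_square_integrable:
  assumes "ls_functional \<Omega> \<beta> \<nu> \<gamma> (\<lambda>_. 0) (\<lambda>_. 0) v < \<infinity>"
  shows "square_integrable (surface_measure \<Omega>) (\<lambda>x. inflow_weight x * trace \<Omega> \<beta> \<nu> v x)"
proof (rule square_integrableI)
  note t = ls_functional_finite_imp_trace[OF assms]
  then have [measurable]: "trace \<Omega> \<beta> \<nu> v \<in> borel_measurable (surface_measure \<Omega>)"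
    by (simp add: is_trace_def)
  show "(\<lambda>x. inflow_weight x * trace \<Omega> \<beta> \<nu> v x) \<in> borel_measurable (surface_measure \<Omega>)"
    by measurable
  have "(\<integral>\<^sup>+x. ennreal ((inflow_weight x * trace \<Omega> \<beta> \<nu> v x)\<^sup>2) \<partial>surface_measure \<Omega>) < \<infinity>"
    using assms unfolding ls_functional_eq[OF t] by auto
  then show "integrable (surface_measure \<Omega>) (\<lambda>x. (inflow_weight x * trace \<Omega> \<beta> \<nu> v x)\<^sup>2)"
    by (intro integrableI_nonneg) auto
qed

text \<open>\<open>g\<close> is known to be measurable only on the inflow boundary; the indicator in
  the weight extends it by zero to the frontier. The other factor, the root of the normal component,
  is bounded almost everywhere.\<close>

lemma weighted_data_square_integrable:
  assumes g: "square_integrable (restrict_space (surface_measure \<Omega>) (inflow_boundary \<Omega> \<beta> \<nu>)) g"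
  shows "square_integrable (surface_measure \<Omega>) (\<lambda>x. inflow_weight x * g x)"
proof -
  let ?\<Gamma> = "inflow_boundary \<Omega> \<beta> \<nu>"
  let ?g = "\<lambda>x. indicator ?\<Gamma> x * g x"
  have \<Gamma>: "?\<Gamma> \<inter> space (surface_measure \<Omega>) \<in> sets (surface_measure \<Omega>)"
    using inflow_boundary_sets by auto
  have sq: "(\<lambda>x. indicator ?\<Gamma> x *\<^sub>R (g x)\<^sup>2) = (\<lambda>x. (?g x)\<^sup>2)"
    by (auto simp: indicator_def)
  have sqg: "square_integrable (surface_measure \<Omega>) ?g"
    using g borel_measurable_restrict_space_iff[OF \<Gamma>, of g] integrable_restrict_space[OF \<Gamma>, of "\<lambda>x. (g x)\<^sup>2"]
    unfolding square_integrable_def sq by simp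
  obtain C where C: "AE x in surface_measure \<Omega>. \<bar>inner (\<beta> x) (\<nu> x)\<bar> \<le> C"
    by (rule normal_component_bounded)
  have sqrtC: "AE x in surface_measure \<Omega>. \<bar>sqrt \<bar>inner (\<beta> x) (\<nu> x)\<bar>\<bar> \<le> sqrt C"
    using C by eventually_elim simp
  have "square_integrable (surface_measure \<Omega>) (\<lambda>x. sqrt \<bar>inner (\<beta> x) (\<nu> x)\<bar> * ?g x)"
    by (rule square_integrable_bounded_mult[OF sqg _ sqrtC]) measurable
  then show ?thesis
    by (simp add: inflow_weight_def ac_simps)
qed

lemma weighted_trace_linear:
  assumes "v \<in> V_space \<Omega> \<beta>" "w \<in> V_space \<Omega> \<beta>" "is_trace \<Omega> \<beta> \<nu> v t" "is_trace \<Omega> \<beta> \<nu> w t'"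
  shows "AE x in surface_measure \<Omega>. inflow_weight x * trace \<Omega> \<beta> \<nu> (\<lambda>x. v x + r * w x) x =
    inflow_weight x * trace \<Omega> \<beta> \<nu> v x + r * (inflow_weight x * trace \<Omega> \<beta> \<nu> w x)"
  using trace_linear[OF assms, of r]
  by eventually_elim (auto simp: inflow_weight_def inflow_boundary_def indicator_def algebra_simps)

text \<open>The data enter only the part that is constant in r, so the quadratic coefficient is the
  functional of w with zero data. Nonnegativity of the polynomial is recorded because
  \<open>ennreal\<close> sends negative reals to 0: only with it can inequalities between values be
  read back in the reals.\<close>

lemma ls_functional_expand:
  assumes \<gamma>: "continuous_on (closure \<Omega>) \<gamma>"
    and f: "square_integrable (lebesgue_on \<Omega>) f"
    and g: "square_integrable (restrict_space (surface_measure \<Omega>) (inflow_boundary \<Omega> \<beta> \<nu>)) g"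
    and v: "v \<in> V_space \<Omega> \<beta>" "ls_functional \<Omega> \<beta> \<nu> \<gamma> (\<lambda>_. 0) (\<lambda>_. 0) v < \<infinity>"
    and w: "w \<in> V_space \<Omega> \<beta>" "ls_functional \<Omega> \<beta> \<nu> \<gamma> (\<lambda>_. 0) (\<lambda>_. 0) w < \<infinity>"
  obtains a b c where "ls_functional \<Omega> \<beta> \<nu> \<gamma> (\<lambda>_. 0) (\<lambda>_. 0) w = ennreal c" "0 \<le> c" "0 \<le> a"
    "\<And>r. 0 \<le> a + 2 * r * b + r\<^sup>2 * c"
    "\<And>r. ls_functional \<Omega> \<beta> \<nu> \<gamma> f g (\<lambda>x. v x + r * w x) = ennreal (a + 2 * r * b + r\<^sup>2 * c)"
proof -
  let ?L = "lebesgue_on \<Omega>" and ?S = "surface_measure \<Omega>"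
  define p where "p x = residual \<gamma> v x - f x" for x
  define p' where "p' = residual \<gamma> w"
  define q where "q x = inflow_weight x * trace \<Omega> \<beta> \<nu> v x - inflow_weight x * g x" for x
  define q' where "q' x = inflow_weight x * trace \<Omega> \<beta> \<nu> w x" for x
  have p: "square_integrable ?L p" "square_integrable ?L p'"
    unfolding p_def p'_def
    by (intro square_integrable_diff residual_square_integrable \<gamma> f v w)+
  have q: "square_integrable ?S q" "square_integrable ?S q'"
    unfolding q_def q'_def
    by (intro square_integrable_diff weighted_trace_square_integrable[OF v(2)]
        weighted_trace_square_integrable[OF w(2)] weighted_data_square_integrable g)+
  note t = ls_functional_finite_imp_trace[OF v(2)] ls_functional_finite_imp_trace[OF w(2)]
  note [simp] = square_integrable_integrable_sq
  define J where "J r = (\<integral>x. (p x + r * p' x)\<^sup>2 \<partial>?L) + (\<integral>x. (q x + r * q' x)\<^sup>2 \<partial>?S)" for r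
  have J0: "0 \<le> J r" for r
    unfolding J_def by simp
  have ls: "ls_functional \<Omega> \<beta> \<nu> \<gamma> f g (\<lambda>x. v x + r * w x) = ennreal (J r)" for r
  proof -
    have "AE x in ?L. ennreal ((residual \<gamma> (\<lambda>x. v x + r * w x) x - f x)\<^sup>2) = ennreal ((p x + r * p' x)\<^sup>2)"
      using residual_linear[OF v(1) w(1), of \<gamma> r]
      by eventually_elim (simp add: p_def p'_def algebra_simps)
    then have 1: "(\<integral>\<^sup>+x. ennreal ((residual \<gamma> (\<lambda>x. v x + r * w x) x - f x)\<^sup>2) \<partial>?L) =
        (\<integral>\<^sup>+x. ennreal ((p x + r * p' x)\<^sup>2) \<partial>?L)"
      by (rule nn_integral_cong_AE)
    have "AE x in ?S. ennreal ((inflow_weight x * (trace \<Omega> \<beta> \<nu> (\<lambda>x. v x + r * w x) x - g x))\<^sup>2) =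
        ennreal ((q x + r * q' x)\<^sup>2)"
      using weighted_trace_linear[OF v(1) w(1) t, of r]
      by eventually_elim (simp add: q_def q'_def right_diff_distrib diff_add_eq)
    then have 2: "(\<integral>\<^sup>+x. ennreal ((inflow_weight x * (trace \<Omega> \<beta> \<nu> (\<lambda>x. v x + r * w x) x - g x))\<^sup>2) \<partial>?S) =
        (\<integral>\<^sup>+x. ennreal ((q x + r * q' x)\<^sup>2) \<partial>?S)"
      by (rule nn_integral_cong_AE)
    have "integrable ?L (\<lambda>x. (p x + r * p' x)\<^sup>2)" "integrable ?S (\<lambda>x. (q x + r * q' x)\<^sup>2)"
      by (intro square_integrable_integrable_sq square_integrable_add square_integrable_cmult p q)+
    then show ?thesis
      unfolding ls_functional_eq[OF is_trace_linear[OF v(1) w(1) t]] 1 2 J_def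
      by (simp add: nn_integral_eq_integral ennreal_plus)
  qed
  have expand: "J r = ((\<integral>x. (p x)\<^sup>2 \<partial>?L) + (\<integral>x. (q x)\<^sup>2 \<partial>?S)) +
      2 * r * ((\<integral>x. p x * p' x \<partial>?L) + (\<integral>x. q x * q' x \<partial>?S)) +
      r\<^sup>2 * ((\<integral>x. (p' x)\<^sup>2 \<partial>?L) + (\<integral>x. (q' x)\<^sup>2 \<partial>?S))" for r
    unfolding J_def integral_square_expand[OF p] integral_square_expand[OF q]
    by (simp add: algebra_simps)
  have "ls_functional \<Omega> \<beta> \<nu> \<gamma> (\<lambda>_. 0) (\<lambda>_. 0) w =
      ennreal ((\<integral>x. (p' x)\<^sup>2 \<partial>?L) + (\<integral>x. (q' x)\<^sup>2 \<partial>?S))"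
    unfolding ls_functional_eq[OF t(2)] using p q
    by (simp add: nn_integral_eq_integral ennreal_plus p'_def[symmetric] q'_def[symmetric])
  from that[OF this, where a = "(\<integral>x. (p x)\<^sup>2 \<partial>?L) + (\<integral>x. (q x)\<^sup>2 \<partial>?S)"
      and b = "(\<integral>x. p x * p' x \<partial>?L) + (\<integral>x. q x * q' x \<partial>?S)"]
  show ?thesis
    using ls J0 unfolding expand by simp
qed

lemma ls_functional_minimizer:
  assumes \<gamma>: "continuous_on (closure \<Omega>) \<gamma>"
    and f: "square_integrable (lebesgue_on \<Omega>) f"
    and g: "square_integrable (restrict_space (surface_measure \<Omega>) (inflow_boundary \<Omega> \<beta> \<nu>)) g"
    and fin: "\<And>v. v \<in> V_space \<Omega> \<beta> \<Longrightarrow> ls_functional \<Omega> \<beta> \<nu> \<gamma> (\<lambda>_. 0) (\<lambda>_. 0) v < \<infinity>"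
    and u: "is_arg_min (ls_functional \<Omega> \<beta> \<nu> \<gamma> f g) (\<lambda>v. v \<in> V_space \<Omega> \<beta>) u"
    and v: "v \<in> V_space \<Omega> \<beta>"
  shows "ls_functional \<Omega> \<beta> \<nu> \<gamma> f g v =
      ls_functional \<Omega> \<beta> \<nu> \<gamma> f g u + ls_functional \<Omega> \<beta> \<nu> \<gamma> (\<lambda>_. 0) (\<lambda>_. 0) (\<lambda>x. u x - v x)"
    and "ls_functional \<Omega> \<beta> \<nu> \<gamma> f g u < \<infinity>"
proof -
  have uV: "u \<in> V_space \<Omega> \<beta>"
    using u by (simp add: is_arg_min_def)
  have wV: "(\<lambda>x. u x - v x) \<in> V_space \<Omega> \<beta>"
    using V_space_linear[OF uV v, of "-1"] by simp
  obtain a b c where c: "ls_functional \<Omega> \<beta> \<nu> \<gamma> (\<lambda>_. 0) (\<lambda>_. 0) (\<lambda>x. u x - v x) = ennreal c" "0 \<le> c" "0 \<le> a"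
    and nonneg: "\<And>r. 0 \<le> a + 2 * r * b + r\<^sup>2 * c"
    and eq: "\<And>r. ls_functional \<Omega> \<beta> \<nu> \<gamma> f g (\<lambda>x. u x + r * (u x - v x)) = ennreal (a + 2 * r * b + r\<^sup>2 * c)"
    by (rule ls_functional_expand[OF \<gamma> f g uV fin[OF uV] wV fin[OF wV]]) (rule that)
  have a: "ls_functional \<Omega> \<beta> \<nu> \<gamma> f g u = ennreal a"
    using eq[of 0] by simp
  have "2 * r * b + r\<^sup>2 * c \<ge> 0" for r
  proof -
    have "ls_functional \<Omega> \<beta> \<nu> \<gamma> f g u \<le> ls_functional \<Omega> \<beta> \<nu> \<gamma> f g (\<lambda>x. u x + r * (u x - v x))"
      using u V_space_linear[OF uV wV, of r] by (simp add: is_arg_min_linorder)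
    then show ?thesis
      using nonneg[of r] by (simp add: a eq ennreal_le_iff)
  qed
  then have "b = 0"
    by (rule quadratic_nonneg_imp_linear_zero[OF c(2)])
  \<comment> \<open>Since u - (u - v) is v, the value at v is that of the polynomial at r = -1,
    which is a + c once b = 0.\<close>
  then show "ls_functional \<Omega> \<beta> \<nu> \<gamma> f g v =
      ls_functional \<Omega> \<beta> \<nu> \<gamma> f g u + ls_functional \<Omega> \<beta> \<nu> \<gamma> (\<lambda>_. 0) (\<lambda>_. 0) (\<lambda>x. u x - v x)"
    using eq[of "-1"] c by (simp add: a ennreal_plus)
  show "ls_functional \<Omega> \<beta> \<nu> \<gamma> f g u < \<infinity>"
    by (simp add: a)
qed

end

theorem lemma3p1:
  fixes \<Omega> :: "'a::euclidean_space set"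
    and \<beta> \<nu> :: "'a \<Rightarrow> 'a"
    and \<gamma> f g u u\<^sub>N :: "'a \<Rightarrow> real"
    and \<gamma>\<^sub>0 \<alpha> M :: real
    and L :: nat and n :: "nat \<Rightarrow> nat"
  assumes "bounded_lipschitz_domain \<Omega>"
    and "outward_unit_normal \<Omega> \<nu>"
    and "C1_closure \<Omega> \<beta>"
    and "continuous_on (closure \<Omega>) \<gamma>"
    and "square_integrable (lebesgue_on \<Omega>) f"
    and "square_integrable (restrict_space (surface_measure \<Omega>) (inflow_boundary \<Omega> \<beta> \<nu>)) g"
    and "bounded (g ` inflow_boundary \<Omega> \<beta> \<nu>)"
    and "\<gamma>\<^sub>0 > 0"
    and "\<And>x. x \<in> \<Omega> \<Longrightarrow> \<gamma> x + 1/2 * divergence \<beta> x \<ge> \<gamma>\<^sub>0"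
    and "L \<ge> 1" and "n 0 = DIM('a)" and "\<And>l. 1 \<le> l \<Longrightarrow> l < L \<Longrightarrow> n l \<ge> 1" and "n L = 1"
    and "\<alpha> > 0" and "M > 0"
    and "\<And>v. v \<in> V_space \<Omega> \<beta> \<Longrightarrow>
           ennreal (\<alpha> * (graph_norm \<Omega> \<beta> v)\<^sup>2) \<le> ls_functional \<Omega> \<beta> \<nu> \<gamma> (\<lambda>_. 0) (\<lambda>_. 0) v \<and>
           ls_functional \<Omega> \<beta> \<nu> \<gamma> (\<lambda>_. 0) (\<lambda>_. 0) v \<le> ennreal (M * (graph_norm \<Omega> \<beta> v)\<^sup>2)"
    and "is_arg_min (ls_functional \<Omega> \<beta> \<nu> \<gamma> f g) (\<lambda>v. v \<in> V_space \<Omega> \<beta>) u"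
    and "is_arg_min (ls_functional \<Omega> \<beta> \<nu> \<gamma> f g) (\<lambda>v. v \<in> relu_networks n L) u\<^sub>N"
  shows "graph_norm \<Omega> \<beta> (\<lambda>x. u x - u\<^sub>N x) \<le>
           sqrt (M / \<alpha>) * (INF v \<in> relu_networks n L. graph_norm \<Omega> \<beta> (\<lambda>x. u x - v x))"
proof -
  interpret flow_domain \<Omega> \<beta> \<nu>
    using assms(1-3) by unfold_locales (auto simp: bounded_lipschitz_domain_def)
  note equiv = assms(16) and u_min = assms(17) and uN_min = assms(18)
  let ?L = "ls_functional \<Omega> \<beta> \<nu> \<gamma> f g" and ?H = "ls_functional \<Omega> \<beta> \<nu> \<gamma> (\<lambda>_. 0) (\<lambda>_. 0)"
  have gn0: "0 \<le> graph_norm \<Omega> \<beta> v" for v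
    by (simp add: graph_norm_def)
  have fin: "?H v < \<infinity>" if "v \<in> V_space \<Omega> \<beta>" for v
    using equiv[OF that] by (auto intro: le_less_trans)
  have net: "v \<in> V_space \<Omega> \<beta>" if "v \<in> relu_networks n L" for v
    using that assms(10,11,13)
    by (intro piecewise_affine_in_V_space[OF open_domain bounded_domain C1_field] piecewise_affine_network)
  have uV: "u \<in> V_space \<Omega> \<beta>" and uN: "u\<^sub>N \<in> relu_networks n L"
    using u_min uN_min by (auto simp: is_arg_min_def)
  have diffV: "(\<lambda>x. u x - v x) \<in> V_space \<Omega> \<beta>" if "v \<in> V_space \<Omega> \<beta>" for v
    using V_space_linear[OF uV that, of "-1"] by simp
  have pythagoras: "?L v = ?L u + ?H (\<lambda>x. u x - v x)" if "v \<in> V_space \<Omega> \<beta>" for v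
    by (rule ls_functional_minimizer(1)[OF assms(4-6) _ u_min that]) (rule fin)
  have u_fin: "?L u < \<infinity>"
    by (rule ls_functional_minimizer(2)[OF assms(4-6) _ u_min uV]) (rule fin)
  have best: "graph_norm \<Omega> \<beta> (\<lambda>x. u x - u\<^sub>N x) \<le> sqrt (M / \<alpha>) * graph_norm \<Omega> \<beta> (\<lambda>x. u x - v x)"
    if v: "v \<in> relu_networks n L" for v
  proof -
    let ?a = "graph_norm \<Omega> \<beta> (\<lambda>x. u x - u\<^sub>N x)" and ?b = "graph_norm \<Omega> \<beta> (\<lambda>x. u x - v x)"
    have "?L u\<^sub>N \<le> ?L v"
      using uN_min v by (simp add: is_arg_min_linorder)
    \<comment> \<open>Both values share the summand \<open>?L u\<close>, which may be cancelled in
      \<open>ennreal\<close> because it is finite.\<close>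
    then have "?H (\<lambda>x. u x - u\<^sub>N x) \<le> ?H (\<lambda>x. u x - v x)"
      using u_fin unfolding pythagoras[OF net[OF v]] pythagoras[OF net[OF uN]]
      by (auto simp: ennreal_add_left_cancel_le)
    \<comment> \<open>The lower bound is applied to the error of \<open>u\<^sub>N\<close> and the
      upper bound to that of v; this is the origin of the quotient M / \<alpha>.\<close>
    then have "ennreal (\<alpha> * ?a\<^sup>2) \<le> ennreal (M * ?b\<^sup>2)"
      using equiv[OF diffV[OF net[OF uN]]] equiv[OF diffV[OF net[OF v]]] by (meson order_trans)
    then have "\<alpha> * ?a\<^sup>2 \<le> M * ?b\<^sup>2"
      using assms(15) by (simp add: ennreal_le_iff)
    then have "?a\<^sup>2 \<le> M / \<alpha> * ?b\<^sup>2"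
      using assms(14) by (simp add: field_simps)
    then have "sqrt (?a\<^sup>2) \<le> sqrt (M / \<alpha> * ?b\<^sup>2)"
      by (rule real_sqrt_le_mono)
    then show ?thesis
      by (simp only: real_sqrt_mult real_sqrt_abs abs_of_nonneg[OF gn0])
  qed
  have pos: "0 < sqrt (M / \<alpha>)"
    by (intro real_sqrt_gt_zero divide_pos_pos assms(14,15))
  \<comment> \<open>With the positive constant moved to the left, the estimate is a common lower
    bound of a family that is nonempty thanks to \<open>u\<^sub>N\<close>, and so passes to the
    infimum.\<close>
  have "graph_norm \<Omega> \<beta> (\<lambda>x. u x - u\<^sub>N x) / sqrt (M / \<alpha>) \<le>
      (INF v \<in> relu_networks n L. graph_norm \<Omega> \<beta> (\<lambda>x. u x - v x))"
  proof (rule cINF_greatest)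
    show "graph_norm \<Omega> \<beta> (\<lambda>x. u x - u\<^sub>N x) / sqrt (M / \<alpha>) \<le> graph_norm \<Omega> \<beta> (\<lambda>x. u x - v x)"
      if "v \<in> relu_networks n L" for v
      unfolding pos_divide_le_eq[OF pos] using best[OF that] by (simp only: mult.commute)
  qed (use uN in blast)
  then show ?thesis
    unfolding pos_divide_le_eq[OF pos] by (simp only: mult.commute)
qed

end
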